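(* Let $\mathscr{D}$ be as in the context. Let $\alpha:[1,\infty)\to\mathbb{R}_+$ be an increasing function such that $$C_\alpha:=\frac{1}{\alpha(1)}+\int_1^\infty\frac{dt}{t\alpha(t)}<\infty ,$$ and let $u$ be a weight. Then for every $f\in L^2(u)$, $$\sum_{I\in\mathscr{D}}\frac{\|\Delta_I(fu)\|^2_{L^1(I)}}{\alpha(\mathbf{u}^*_I/\mathbf{u}_I)\,\mathbf{u}^*_I}\,|I|\le 36\,C_\alpha\,\|f\|^2_{L^2(u)} .$$
   Context: Setting: $(\mathcal{X},\mu)$ is a $\sigma$-finite measure space with an increasing filtration of atomic $\sigma$-algebras $\mathfrak{S}_n$, $n\in\mathbb{Z}$. Each $\mathfrak{S}_n$ is generated by a countable disjoint collection $\mathscr{D}_n$ of sets of positive measure such that every set of $\mathfrak{S}_n$ is a union of sets of $\mathscr{D}_n$. Put $\mathscr{D}=\bigcup_n\mathscr{D}_n$; a set may lie in several $\mathscr{D}_n$, but not in all of them. Write $|A|=\mu(A)$. Children: for $I\in\mathscr{D}$, if $n$ is the largest integer with $I\in\mathscr{D}_n$, then $\operatorname{ch}(I)=\{I'\in\mathscr{D}_{n+1}:I'\subset I\}$; if $I\in\mathscr{D}_n$ for all large $n$, then $\operatorname{ch}(I)=\{I\}$. Notation: $\langle f\rangle_I=|I|^{-1}\int_If\,d\mu$, $\Delta_If=\sum_{I'\in\operatorname{ch}(I)}\langle f\rangle_{I'}\mathbf{1}_{I'}-\langle f\rangle_I\mathbf{1}_I$, and $\|g\|_{L^1(I)}=|I|^{-1}\int_I|g|\,d\mu$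 (normalized). Weights and bumps: a weight is a nonnegative function integrable on each $I\in\mathscr{D}$. We set $\mathbf{u}_I=\langle u\rangle_I$ and $$\mathbf{u}^*_I=\int_0^\infty\psi_0\big(|I|^{-1}|\{x\in I:u(x)>t\}|\big)\,dt,\qquad \psi_0(s)=s\ln(e/s).$$ *)

theory Defs
  imports "HOL-Analysis.Analysis"
begin

definition gen_sa :: "'a measure \<Rightarrow> (int \<Rightarrow> 'a set set) \<Rightarrow> int \<Rightarrow> 'a set set" where
  "gen_sa M D n = sigma_sets (space M) (D n)"

definition atomic_filtration :: "'a measure \<Rightarrow> (int \<Rightarrow> 'a set set) \<Rightarrow> bool" where
  "atomic_filtration M D \<longleftrightarrow>
     sigma_finite_measure M \<and>
     (\<forall>n. countable (D n)) \<and>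
     (\<forall>n. disjoint (D n)) \<and>
     (\<forall>n. \<forall>I\<in>D n. I \<in> sets M \<and> 0 < emeasure M I \<and> emeasure M I < \<infinity>) \<and>
     (\<forall>n. gen_sa M D n \<subseteq> sets M) \<and>
     (\<forall>n. \<forall>A\<in>gen_sa M D n. \<exists>F\<subseteq>D n. A = \<Union>F) \<and>
     (\<forall>n. gen_sa M D n \<subseteq> gen_sa M D (n + 1)) \<and>
     (\<forall>I. \<not> (\<forall>n. I \<in> D n))"

definition allD :: "(int \<Rightarrow> 'a set set) \<Rightarrow> 'a set set" where
  "allD D = (\<Union>n. D n)"

definition ch :: "(int \<Rightarrow> 'a set set) \<Rightarrow> 'a set \<Rightarrow> 'a set set" where
  "ch D I =
     (if \<exists>n. I \<in> D n \<and> (\<forall>m>n. I \<notin> D m)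
      then (let n = (THE n. I \<in> D n \<and> (\<forall>m>n. I \<notin> D m))
            in {I' \<in> D (n + 1). I' \<subseteq> I})
      else {I})"

definition avg :: "'a measure \<Rightarrow> ('a \<Rightarrow> real) \<Rightarrow> 'a set \<Rightarrow> real" where
  "avg M g I = (LINT x:I|M. g x) / measure M I"

definition Delta :: "'a measure \<Rightarrow> (int \<Rightarrow> 'a set set) \<Rightarrow> 'a set \<Rightarrow> ('a \<Rightarrow> real) \<Rightarrow> 'a \<Rightarrow> real" where
  "Delta M D I g x =
     (\<Sum>\<^sub>\<infinity>I'\<in>ch D I. avg M g I' * indicator I' x) - avg M g I * indicator I x"

definition L1norm :: "'a measure \<Rightarrow> ('a \<Rightarrow> real) \<Rightarrow> 'a set \<Rightarrow> real" where
  "L1norm M g I = avg M (\<lambda>x. \<bar>g x\<bar>) I"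

definition psi0 :: "real \<Rightarrow> real" where
  "psi0 s = s * ln (exp 1 / s)"

definition ustar :: "'a measure \<Rightarrow> ('a \<Rightarrow> real) \<Rightarrow> 'a set \<Rightarrow> real" where
  "ustar M u I = enn2real (\<integral>\<^sup>+ t \<in> {0<..}.
       ennreal (psi0 (measure M {x \<in> I. u x > t} / measure M I)) \<partial>lborel)"

end

theory Submission
  imports Defs
begin

text \<open>
  Write \<open>x = \<langle>fu\<rangle>\<^sub>I\<close>, \<open>q = x / u\<^sub>I\<close>. On a child \<open>J\<close>, \<open>\<langle>fu\<rangle>\<^sub>J - x\<close> splits as \<open>(\<langle>fu\<rangle>\<^sub>J - q u\<^sub>J) + q (u\<^sub>J - u\<^sub>I)\<close>.
  The mean of the first part is controlled by the increment of the convex function \<open>x\<^sup>2 / u\<close>. For the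
  second part, a Pinsker-type inequality for \<open>\<psi>\<^sub>0\<close>, applied to the distribution functions of \<open>u\<close> and
  integrated over the level \<open>t\<close>, shows that the mean of \<open>u\<^sup>*\<close> over the children drops by at least
  \<open>\<parallel>\<Delta>\<^sub>I u\<parallel>\<^sup>2 / (4 u\<^sub>I)\<close>. Composing with the concave function \<open>\<phi>(s) = \<integral>\<^sub>1\<^sup>s dt / (t \<alpha>(t))\<close> turns this into
  a drop of \<open>\<parallel>\<Delta>\<^sub>I u\<parallel>\<^sup>2 / (4 \<alpha>(u\<^sup>*\<^sub>I / u\<^sub>I) u\<^sup>*\<^sub>I)\<close> for the potential \<open>m\<^sub>I = u\<^sub>I \<phi>(u\<^sup>*\<^sub>I / u\<^sub>I) \<le> C\<^sub>\<alpha> u\<^sub>I\<close>, and the convex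
  function \<open>x\<^sup>2 / (C\<^sub>\<alpha> u + m)\<close>, decreasing in \<open>m\<close>, converts the drop into the required Carleson embedding.
  Hence \<open>2 x\<^sup>2 / (\<alpha>(1) u) + 32 C\<^sub>\<alpha>\<^sup>2 x\<^sup>2 / (C\<^sub>\<alpha> u + m)\<close>, which is at most \<open>34 C\<^sub>\<alpha> \<langle>f\<^sup>2 u\<rangle>\<^sub>I\<close>, gains at least one
  summand per cell.
\<close>

subsection \<open>Integrals over countable partitions\<close>

lemma has_sum_diff:
  fixes f g :: "'a \<Rightarrow> 'b :: topological_ab_group_add"
  assumes "(f has_sum a) A" "(g has_sum b) A"
  shows "((\<lambda>x. f x - g x) has_sum (a - b)) A"
  using has_sum_add[OF assms(1), of "\<lambda>x. - g x" "- b"] assms(2) by (simp add: has_sum_uminus)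

lemma has_sum_measure_Union:
  assumes K: "countable K" "disjoint K" "K \<subseteq> sets M" and fin: "emeasure M (\<Union>K) \<noteq> \<infinity>"
  shows "(measure M has_sum measure M (\<Union>K)) K"
proof (cases "finite K")
  case True
  have "measure M (\<Union>A\<in>K. A) = (\<Sum>A\<in>K. measure M A)"
  proof (rule measure_finite_Union)
    show "emeasure M A \<noteq> \<infinity>" if "A \<in> K" for A
    proof -
      have "\<Union>K \<in> sets M" using K by blast
      then have "emeasure M A \<le> emeasure M (\<Union>K)"
        using that by (intro emeasure_mono) auto
      then show ?thesis using fin by (auto simp: top_unique)
    qed
  qed (use True K in \<open>auto simp: disjoint_family_on_def disjoint_def\<close>)
  then show ?thesis
    using True by (simp add: has_sum_finiteI)
next
  case False
  define e where "e = from_nat_into K"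
  have e: "bij_betw e UNIV K"
    using K(1) False unfolding e_def by (rule bij_betw_from_nat_into)
  have rng: "(\<Union>i. e i) = \<Union>K"
    using e by (auto simp: bij_betw_def)
  have "disjoint_family e"
    unfolding disjoint_family_on_def
  proof (intro ballI impI)
    fix i j :: nat assume "i \<noteq> j"
    then have "e i \<noteq> e j" "e i \<in> K" "e j \<in> K"
      using e by (auto simp: bij_betw_def inj_eq)
    then show "e i \<inter> e j = {}"
      using K(2) by (simp add: disjointD)
  qed
  moreover have "range e \<subseteq> sets M"
    using e K(3) by (simp add: bij_betw_def)
  ultimately have "(\<lambda>i. measure M (e i)) sums measure M (\<Union>i. e i)"
    using fin unfolding rng[symmetric] by (intro measure_UNION)
  then have "((\<lambda>i. measure M (e i)) has_sum measure M (\<Union>K)) UNIV"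
    by (subst rng[symmetric], intro sums_nonneg_imp_has_sum) auto
  then show ?thesis
    using has_sum_reindex_bij_betw[OF e, of "measure M" "measure M (\<Union>K)"] by simp
qed

text \<open>Countable additivity of the measure with density g. The density is cut off outside the
  union of K because g is only assumed integrable there; the resulting measure is finite on the
  union, so \<open>has_sum_measure_Union\<close> applies.\<close>

lemma has_sum_set_integral_nonneg:
  fixes g :: "'a \<Rightarrow> real"
  assumes K: "countable K" "disjoint K" "K \<subseteq> sets M"
    and g: "set_integrable M (\<Union>K) g" and nonneg: "\<And>x. 0 \<le> g x"
  shows "((\<lambda>A. LINT x:A|M. g x) has_sum (LINT x:\<Union>K|M. g x)) K"
proof -
  define h where "h x = indicator (\<Union>K) x * g x" for x
  have h: "integrable M h"
    using g by (simp add: set_integrable_def h_def [abs_def])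
  have U: "\<Union>K \<in> sets M"
    using K by blast
  define N where "N = density M (\<lambda>x. ennreal (h x))"
  have eN: "emeasure N A = ennreal (LINT x:A|M. g x)" if A: "A \<in> sets M" "A \<subseteq> \<Union>K" for A
  proof -
    have "set_integrable M A g"
      using g A by (rule set_integrable_subset)
    then have "(\<integral>\<^sup>+x. ennreal (indicator A x * g x) \<partial>M) = ennreal (LINT x:A|M. g x)"
      unfolding set_integrable_def set_lebesgue_integral_def
      by (subst nn_integral_eq_integral) (auto simp: nonneg)
    moreover have "ennreal (h x) * indicator A x = ennreal (indicator A x * g x)" for x
      using A by (auto simp: h_def indicator_def)
    ultimately show ?thesis
      using A h by (simp add: N_def emeasure_density)
  qed
  have mN: "measure N A = (LINT x:A|M. g x)" if A: "A \<in> sets M" "A \<subseteq> \<Union>K" for A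
    using eN[OF A] nonneg
    by (simp add: measure_def set_lebesgue_integral_def integral_nonneg_AE)
  have "(measure N has_sum measure N (\<Union>K)) K"
    using K eN[OF U] by (intro has_sum_measure_Union) (auto simp: N_def)
  moreover have "measure N A = (LINT x:A|M. g x)" if "A \<in> K" for A
    using that K(3) by (intro mN) auto
  ultimately show ?thesis
    using mN[OF U] has_sum_cong[of K "measure N" "\<lambda>A. LINT x:A|M. g x"] by simp
qed

text \<open>Reduction to the nonnegative case through g = |g| - (|g| - g).\<close>

lemma has_sum_set_integral:
  fixes g :: "'a \<Rightarrow> real"
  assumes K: "countable K" "disjoint K" "K \<subseteq> sets M" and g: "set_integrable M (\<Union>K) g"
  shows "((\<lambda>A. LINT x:A|M. g x) has_sum (LINT x:\<Union>K|M. g x)) K"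
proof -
  have abs: "set_integrable M (\<Union>K) (\<lambda>x. \<bar>g x\<bar>)"
    using g by (rule set_integrable_abs)
  have split: "(LINT x:A|M. \<bar>g x\<bar>) - (LINT x:A|M. \<bar>g x\<bar> - g x) = (LINT x:A|M. g x)"
    if "A \<in> sets M" "A \<subseteq> \<Union>K" for A
    using set_integrable_subset[OF g that] set_integrable_subset[OF abs that]
    by (simp add: set_integral_diff)
  have "\<Union>K \<in> sets M"
    using K by blast
  moreover have "((\<lambda>A. (LINT x:A|M. \<bar>g x\<bar>) - (LINT x:A|M. \<bar>g x\<bar> - g x)) has_sum
      ((LINT x:\<Union>K|M. \<bar>g x\<bar>) - (LINT x:\<Union>K|M. \<bar>g x\<bar> - g x))) K"
    using K g abs
    by (intro has_sum_diff has_sum_set_integral_nonneg set_integral_diff) auto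
  moreover have "(LINT x:A|M. \<bar>g x\<bar>) - (LINT x:A|M. \<bar>g x\<bar> - g x) = (LINT x:A|M. g x)"
    if "A \<in> K" for A
    using that K(3) by (intro split) auto
  ultimately show ?thesis
    using has_sum_cong[of K "\<lambda>A. (LINT x:A|M. \<bar>g x\<bar>) - (LINT x:A|M. \<bar>g x\<bar> - g x)"
        "\<lambda>A. LINT x:A|M. g x" "LINT x:\<Union>K|M. g x"] split[of "\<Union>K"] by auto
qed

text \<open>Layer-cake formula with a weight in the level t, by Tonelli on the region under the
  graph of u over J.\<close>

lemma nn_integral_superlevel:
  fixes u :: "'a \<Rightarrow> real" and w :: "real \<Rightarrow> ennreal"
  assumes M: "sigma_finite_measure M" and J: "J \<in> sets M"
    and u [measurable]: "u \<in> borel_measurable M" and w [measurable]: "w \<in> borel_measurable lborel"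
  shows "(\<integral>\<^sup>+t\<in>{0<..}. w t * emeasure M {x \<in> J. t < u x} \<partial>lborel) =
    (\<integral>\<^sup>+x\<in>J. (\<integral>\<^sup>+t. w t * indicator {0<..<u x} t \<partial>lborel) \<partial>M)"
proof -
  interpret sigma_finite_measure M by fact
  interpret pair_sigma_finite lborel M ..
  note J [measurable]
  have "(\<integral>\<^sup>+t\<in>{0<..}. w t * emeasure M {x \<in> J. t < u x} \<partial>lborel) =
    (\<integral>\<^sup>+t. (\<integral>\<^sup>+x. w t * indicator {0<..} t * indicator {x \<in> J. t < u x} x \<partial>M) \<partial>lborel)"
  proof (intro nn_integral_cong)
    fix t :: real
    have "{x \<in> J. t < u x} = {x \<in> space M. x \<in> J \<and> t < u x}"
      using sets.sets_into_space[OF J] by auto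
    also have "\<dots> \<in> sets M"
      by measurable
    finally show "w t * emeasure M {x \<in> J. t < u x} * indicator {0<..} t =
        (\<integral>\<^sup>+x. w t * indicator {0<..} t * indicator {x \<in> J. t < u x} x \<partial>M)"
      by (simp add: nn_integral_cmult_indicator ac_simps flip: mult.assoc)
  qed
  also have "\<dots> = (\<integral>\<^sup>+x. (\<integral>\<^sup>+t. w t * indicator {0<..} t * indicator {x \<in> J. t < u x} x \<partial>lborel) \<partial>M)"
    by (rule Fubini'[symmetric]) (simp add: indicator_def)
  also have "\<dots> = (\<integral>\<^sup>+x\<in>J. (\<integral>\<^sup>+t. w t * indicator {0<..<u x} t \<partial>lborel) \<partial>M)"
    by (intro nn_integral_cong) (auto simp: indicator_def intro!: nn_integral_cong)
  finally show ?thesis .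
qed

subsection \<open>A Pinsker-type inequality for \<open>\<psi>\<^sub>0\<close>\<close>

text \<open>The inequality ln y <= y - 1 at y = 1 / sqrt r, multiplied by 2 r: relative entropy
  dominates the squared Hellinger distance.\<close>

lemma mult_ln_ge:
  fixes r :: real
  assumes "0 \<le> r"
  shows "(sqrt r - 1)\<^sup>2 \<le> r * ln r - r + 1"
proof (cases "r = 0")
  case False
  then have r: "0 < r" using assms by simp
  have "ln (1 / sqrt r) \<le> 1 / sqrt r - 1"
    using r by (intro ln_le_minus_one) simp
  then have "1 - 1 / sqrt r \<le> ln r / 2"
    using r by (simp add: ln_div ln_sqrt)
  then have "2 * r * (1 - 1 / sqrt r) \<le> 2 * r * (ln r / 2)"
    using r by (intro mult_left_mono) auto
  moreover have "2 * r * (1 - 1 / sqrt r) = 2 * r - 2 * sqrt r"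
    using r real_div_sqrt[of r] by (simp add: right_diff_distrib)
  ultimately show ?thesis
    using r by (simp add: power2_eq_square algebra_simps)
qed simp

text \<open>Factor |r - 1| = |sqrt r - 1| (sqrt r + 1), apply l a b <= a^2 + l^2 b^2 / 4, then (sqrt
  r + 1)^2 <= 2 (r + 1). The bound is kept linear in |r - 1|, with a free parameter l, because a
  linear bound survives integration over t and summation over cells; l is optimized only after
  both.\<close>

lemma weighted_abs_le_mult_ln:
  fixes r l :: real
  assumes "0 \<le> r"
  shows "l * \<bar>r - 1\<bar> \<le> r * ln r - r + 1 + l\<^sup>2 / 2 * (r + 1)"
proof -
  have "\<bar>r - 1\<bar> = \<bar>sqrt r - 1\<bar> * (sqrt r + 1)"
  proof -
    have "r - 1 = (sqrt r - 1) * (sqrt r + 1)"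
      using assms by (simp add: algebra_simps)
    then show ?thesis
      using assms by (simp add: abs_mult)
  qed
  moreover have "l * (a * b) \<le> a\<^sup>2 + l\<^sup>2 / 4 * b\<^sup>2" for a b :: real
    using zero_le_power2[of "a - l / 2 * b"] by (simp add: power2_eq_square algebra_simps)
  ultimately have "l * \<bar>r - 1\<bar> \<le> (sqrt r - 1)\<^sup>2 + l\<^sup>2 / 4 * (sqrt r + 1)\<^sup>2"
    by (metis power2_abs)
  moreover have "l\<^sup>2 / 4 * (2 * (r + 1)) = l\<^sup>2 / 2 * (r + 1)"
    by simp
  moreover have "l\<^sup>2 / 4 * (sqrt r + 1)\<^sup>2 \<le> l\<^sup>2 / 4 * (2 * (r + 1))"
  proof (rule mult_left_mono)
    have "0 \<le> (sqrt r - 1)\<^sup>2" by simp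
    then show "(sqrt r + 1)\<^sup>2 \<le> 2 * (r + 1)"
      using assms by (simp add: power2_eq_square algebra_simps)
  qed simp
  ultimately show ?thesis
    using mult_ln_ge[OF assms] by linarith
qed

text \<open>The term s ln (1 / S) + S is the tangent line of the concave \<open>psi0\<close> at S,
  evaluated at s, so this measures how far \<open>psi0\<close> lies below its tangent. For positive
  s and S it is S times \<open>weighted_abs_le_mult_ln\<close> at r = s / S. At S = 0 the tangent
  would be vertical, hence the hypothesis forcing s = 0.\<close>

lemma psi0_Bregman:
  fixes s S l :: real
  assumes "0 \<le> s" "0 \<le> S" "S = 0 \<Longrightarrow> s = 0" "0 \<le> l"
  shows "l * \<bar>s - S\<bar> + psi0 s \<le> s * ln (1 / S) + S + l\<^sup>2 / 2 * (s + S)"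
proof -
  consider "S = 0" | "0 < S" "s = 0" | "0 < S" "0 < s"
    using assms by linarith
  then show ?thesis
  proof cases
    case 1
    then show ?thesis using assms by (simp add: psi0_def)
  next
    case 2
    have "0 \<le> (l - 1)\<^sup>2" by simp
    then have "l \<le> 1 + l\<^sup>2 / 2"
      by (simp add: power2_eq_square algebra_simps)
    then have "S * l \<le> S * (1 + l\<^sup>2 / 2)"
      using 2 by (intro mult_left_mono) auto
    then show ?thesis
      using 2 by (simp add: psi0_def algebra_simps)
  next
    case 3
    define r where "r = s / S"
    have s: "s = r * S" and r: "0 < r"
      using 3 by (auto simp: r_def)
    have abs: "\<bar>s - S\<bar> = S * \<bar>r - 1\<bar>"
    proof -
      have "s - S = S * (r - 1)"
        by (simp add: s algebra_simps)
      then show ?thesis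
        using 3 by (simp add: abs_mult)
    qed
    have psi: "psi0 s = s - s * ln r - s * ln S"
      using 3 r by (simp add: psi0_def s ln_div ln_mult algebra_simps)
    have "S * (l * \<bar>r - 1\<bar>) \<le> S * (r * ln r - r + 1 + l\<^sup>2 / 2 * (r + 1))"
      using r 3 by (intro mult_left_mono weighted_abs_le_mult_ln) auto
    then show ?thesis
      using 3 unfolding abs psi by (simp add: s ln_div algebra_simps)
  qed
qed

lemma psi0_eq:
  assumes "0 \<le> s"
  shows "psi0 s = s + s * ln (1 / s)"
  using assms by (cases "s = 0") (auto simp: psi0_def ln_div algebra_simps)

lemma psi0_ge:
  assumes "0 \<le> s" "s \<le> 1"
  shows "s \<le> psi0 s"
  using assms by (cases "s = 0") (auto simp: psi0_eq ln_div intro!: mult_nonneg_nonpos)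

subsection \<open>Distribution functions of the weight\<close>

definition tail :: "'a measure \<Rightarrow> ('a \<Rightarrow> real) \<Rightarrow> 'a set \<Rightarrow> real \<Rightarrow> real" where
  "tail M u J t = measure M {x \<in> J. t < u x} / measure M J"

text \<open>\<open>ustar\<close> is the junk value 0 where \<open>u\<^sup>*\<close> is infinite; \<open>nstar\<close> keeps the value \<open>\<infinity>\<close>.\<close>

definition nstar :: "'a measure \<Rightarrow> ('a \<Rightarrow> real) \<Rightarrow> 'a set \<Rightarrow> ennreal" where
  "nstar M u J = (\<integral>\<^sup>+t\<in>{0<..}. ennreal (psi0 (tail M u J t)) \<partial>lborel)"

text \<open>Cross-entropy of the tails: the part of the tangent to \<open>psi0\<close> at the tail
  of I that depends on J, integrated over the levels. It is linear in the tail of J, hence additive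
  over partitions.\<close>

definition cross :: "'a measure \<Rightarrow> ('a \<Rightarrow> real) \<Rightarrow> 'a set \<Rightarrow> 'a set \<Rightarrow> real" where
  "cross M u I J = (LBINT t:{0<..}. tail M u J t * ln (1 / tail M u I t))"

lemma ustar_eq: "ustar M u J = enn2real (nstar M u J)"
  by (simp add: ustar_def nstar_def tail_def)

lemma borel_measurable_psi0 [measurable]: "psi0 \<in> borel_measurable borel"
  unfolding psi0_def [abs_def] by measurable

locale weight = sigma_finite_measure M for M :: "'a measure" +
  fixes u :: "'a \<Rightarrow> real"
  assumes u_meas [measurable]: "u \<in> borel_measurable M"
    and u_nonneg: "\<And>x. x \<in> space M \<Longrightarrow> 0 \<le> u x"
begin

definition cell :: "'a set \<Rightarrow> bool" where
  "cell J \<longleftrightarrow> J \<in> sets M \<and> 0 < emeasure M J \<and> emeasure M J < \<infinity> \<and> set_integrable M J u"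

lemma cell_sets: "cell J \<Longrightarrow> J \<in> sets M"
  by (simp add: cell_def)

lemma cell_emeasure: "cell J \<Longrightarrow> emeasure M J = ennreal (measure M J)"
  unfolding cell_def by (intro emeasure_eq_ennreal_measure) auto

lemma cell_pos:
  assumes "cell J"
  shows "0 < measure M J"
proof -
  have "0 < ennreal (measure M J)"
    using assms unfolding cell_emeasure[OF assms, symmetric] by (simp add: cell_def)
  then show ?thesis by simp
qed

lemma superlevel_sets:
  assumes "J \<in> sets M"
  shows "{x \<in> J. t < u x} \<in> sets M"
proof -
  have "{x \<in> J. t < u x} = {x \<in> space M. x \<in> J \<and> t < u x}"
    using sets.sets_into_space[OF assms] by auto
  also have "\<dots> \<in> sets M"
    using assms by measurable
  finally show ?thesis .
qed

lemma emeasure_superlevel: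
  assumes "cell J"
  shows "emeasure M {x \<in> J. t < u x} = ennreal (measure M J * tail M u J t)"
proof -
  have "emeasure M {x \<in> J. t < u x} \<le> emeasure M J"
    using assms by (intro emeasure_mono) (auto simp: cell_def)
  then have "emeasure M {x \<in> J. t < u x} \<noteq> \<infinity>"
    using assms by (auto simp: cell_def top_unique)
  then show ?thesis
    using cell_pos[OF assms] by (simp add: tail_def emeasure_eq_ennreal_measure)
qed

lemma measure_superlevel_le:
  assumes "cell I" "J \<in> sets M" "J \<subseteq> I" "s \<le> t"
  shows "measure M {x \<in> J. t < u x} \<le> measure M {x \<in> I. s < u x}"
proof (rule measure_mono_fmeasurable)
  have "emeasure M {x \<in> I. s < u x} \<le> emeasure M I"
    using assms by (intro emeasure_mono) (auto simp: cell_def)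
  then show "{x \<in> I. s < u x} \<in> fmeasurable M"
    using assms by (intro fmeasurableI superlevel_sets) (auto simp: cell_def)
qed (use assms in \<open>auto intro: superlevel_sets\<close>)

lemma tail_nonneg [simp]: "0 \<le> tail M u J t"
  by (simp add: tail_def)

lemma tail_le_1:
  assumes "cell J"
  shows "tail M u J t \<le> 1"
proof -
  have "measure M {x \<in> J. t < u x} \<le> measure M J"
  proof (rule measure_mono_fmeasurable)
    show "J \<in> fmeasurable M"
      using assms by (intro fmeasurableI) (auto simp: cell_def)
  qed (use assms in \<open>auto intro: superlevel_sets simp: cell_def\<close>)
  then show ?thesis
    using cell_pos[OF assms] by (simp add: tail_def)
qed

lemma tail_antimono:
  assumes "cell J" "s \<le> t"
  shows "tail M u J t \<le> tail M u J s"
  unfolding tail_def using assms by (intro divide_right_mono measure_superlevel_le) (auto simp: cell_def)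

lemma borel_measurable_tail:
  assumes "cell J"
  shows "tail M u J \<in> borel_measurable borel"
proof -
  have "mono (\<lambda>t. - tail M u J t)"
    using tail_antimono[OF assms] by (auto simp: mono_def)
  then have "(\<lambda>t. - (- tail M u J t)) \<in> borel_measurable borel"
    by (intro borel_measurable_uminus borel_measurable_mono)
  then show ?thesis by simp
qed

lemma tail_subset:
  assumes "cell I" "cell J" "J \<subseteq> I"
  shows "measure M J * tail M u J t \<le> measure M I * tail M u I t"
  using measure_superlevel_le[of I J t t] assms cell_pos[of I] cell_pos[of J]
  by (simp add: tail_def cell_def)

text \<open>The weight w = 1 yields the average of u. The weight ln (1 / tail of I) turns
  \<open>cross\<close> into an integral over J of a function that does not depend on J.\<close>

lemma nn_integral_tail:
  assumes J: "cell J" and w: "w \<in> borel_measurable borel" "\<And>t. 0 \<le> w t"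
  shows "ennreal (measure M J) * (\<integral>\<^sup>+t\<in>{0<..}. ennreal (tail M u J t * w t) \<partial>lborel) =
    (\<integral>\<^sup>+x\<in>J. (\<integral>\<^sup>+t. ennreal (w t) * indicator {0<..<u x} t \<partial>lborel) \<partial>M)"
proof -
  note [measurable] = borel_measurable_tail[OF J] w(1)
  have "ennreal (measure M J) * (\<integral>\<^sup>+t\<in>{0<..}. ennreal (tail M u J t * w t) \<partial>lborel) =
      (\<integral>\<^sup>+t\<in>{0<..}. ennreal (w t) * emeasure M {x \<in> J. t < u x} \<partial>lborel)"
  proof (subst nn_integral_cmult[symmetric], measurable, intro nn_integral_cong)
    fix t
    show "ennreal (measure M J) * (ennreal (tail M u J t * w t) * indicator {0<..} t) =
        ennreal (w t) * emeasure M {x \<in> J. t < u x} * indicator {0<..} t"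
      using w(2)[of t] by (simp add: emeasure_superlevel[OF J] ennreal_mult mult_ac)
  qed
  also have "\<dots> = (\<integral>\<^sup>+x\<in>J. (\<integral>\<^sup>+t. ennreal (w t) * indicator {0<..<u x} t \<partial>lborel) \<partial>M)"
    using J by (intro nn_integral_superlevel sigma_finite_measure_axioms) (auto simp: cell_def)
  finally show ?thesis .
qed

lemma
  assumes J: "cell J"
  shows set_integrable_tail: "set_integrable lborel {0<..} (tail M u J)"
    and set_integral_tail: "(LBINT t:{0<..}. tail M u J t) = avg M u J"
proof -
  note [measurable] = borel_measurable_tail[OF J]
  have "ennreal (measure M J) * (\<integral>\<^sup>+t\<in>{0<..}. ennreal (tail M u J t * 1) \<partial>lborel) =
      (\<integral>\<^sup>+x\<in>J. (\<integral>\<^sup>+t. ennreal 1 * indicator {0<..<u x} t \<partial>lborel) \<partial>M)"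
    by (rule nn_integral_tail[OF J]) auto
  also have "\<dots> = (\<integral>\<^sup>+x. ennreal (indicator J x *\<^sub>R u x) \<partial>M)"
  proof (intro nn_integral_cong)
    fix x assume "x \<in> space M"
    then have "(\<integral>\<^sup>+t. ennreal 1 * indicator {0<..<u x} t \<partial>lborel) = ennreal (u x)"
      using u_nonneg[of x] by simp
    then show "(\<integral>\<^sup>+t. ennreal 1 * indicator {0<..<u x} t \<partial>lborel) * indicator J x =
        ennreal (indicator J x *\<^sub>R u x)"
      by (cases "x \<in> J") simp_all
  qed
  also have "\<dots> = ennreal (LINT x:J|M. u x)"
    using J u_nonneg unfolding cell_def set_integrable_def set_lebesgue_integral_def
    by (intro nn_integral_eq_integral AE_I2) (simp_all add: indicator_def)
  also have "\<dots> = ennreal (measure M J) * ennreal (avg M u J)"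
    using cell_pos[OF J] by (simp add: avg_def flip: ennreal_mult')
  finally have "(\<integral>\<^sup>+t\<in>{0<..}. ennreal (tail M u J t * 1) \<partial>lborel) = ennreal (avg M u J)"
    using cell_pos[OF J] by (simp add: ennreal_mult_cancel_left)
  also have "(\<integral>\<^sup>+t\<in>{0<..}. ennreal (tail M u J t * 1) \<partial>lborel) =
      (\<integral>\<^sup>+t. ennreal (indicator {0<..} t *\<^sub>R tail M u J t) \<partial>lborel)"
    by (intro nn_integral_cong) (simp add: indicator_def)
  finally have *: "(\<integral>\<^sup>+t. ennreal (indicator {0<..} t *\<^sub>R tail M u J t) \<partial>lborel) = ennreal (avg M u J)" .
  have avg: "0 \<le> avg M u J"
    using J u_nonneg unfolding avg_def set_lebesgue_integral_def
    by (intro divide_nonneg_nonneg integral_nonneg_AE AE_I2) (simp_all add: indicator_def)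
  show "set_integrable lborel {0<..} (tail M u J)"
    unfolding set_integrable_def by (rule integrableI_nonneg) (use * in auto)
  show "(LBINT t:{0<..}. tail M u J t) = avg M u J"
    unfolding set_lebesgue_integral_def
    by (subst integral_eq_nn_integral) (use * avg in auto)
qed

lemma tail_subset_eq_0:
  assumes "cell I" "cell J" "J \<subseteq> I" "tail M u I t = 0"
  shows "tail M u J t = 0"
  using tail_subset[OF assms(1-3), of t] assms(4) cell_pos[OF assms(2)] tail_nonneg[of J t]
  by (simp add: mult_le_0_iff)

lemma ln_tail_nonneg:
  assumes "cell J"
  shows "0 \<le> ln (1 / tail M u J t)"
  using tail_le_1[OF assms, of t] tail_nonneg[of J t]
  by (cases "tail M u J t = 0") (simp_all add: ln_div ln_le_zero_iff order_le_less)

lemma psi0_tail_nonneg: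
  assumes "cell J"
  shows "0 \<le> psi0 (tail M u J t)"
  using psi0_ge[OF tail_nonneg tail_le_1[OF assms]] tail_nonneg by (rule order_trans[rotated])

lemma avg_nonneg:
  assumes "J \<in> sets M"
  shows "0 \<le> avg M u J"
  using sets.sets_into_space[OF assms] u_nonneg unfolding avg_def set_lebesgue_integral_def
  by (intro divide_nonneg_nonneg integral_nonneg_AE AE_I2) (simp_all add: indicator_def)

lemma nstar_eq:
  "nstar M u J = (\<integral>\<^sup>+t. ennreal (indicator {0<..} t *\<^sub>R psi0 (tail M u J t)) \<partial>lborel)"
  unfolding nstar_def by (intro nn_integral_cong) (simp add: indicator_def)

lemma
  assumes J: "cell J" and fin: "nstar M u J < \<infinity>"
  shows set_integrable_psi0_tail: "set_integrable lborel {0<..} (\<lambda>t. psi0 (tail M u J t))"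
    and ustar_eq_integral: "ustar M u J = (LBINT t:{0<..}. psi0 (tail M u J t))"
    and avg_le_ustar: "avg M u J \<le> ustar M u J"
proof -
  note [measurable] = borel_measurable_tail[OF J]
  show int: "set_integrable lborel {0<..} (\<lambda>t. psi0 (tail M u J t))"
    unfolding set_integrable_def
    by (rule integrableI_nonneg)
      (use fin psi0_tail_nonneg[OF J] in \<open>auto simp: nstar_eq\<close>)
  show eq: "ustar M u J = (LBINT t:{0<..}. psi0 (tail M u J t))"
    unfolding set_lebesgue_integral_def ustar_eq nstar_eq
    by (subst integral_eq_nn_integral) (use psi0_tail_nonneg[OF J] in auto)
  show "avg M u J \<le> ustar M u J"
    unfolding eq set_integral_tail[OF J, symmetric]
    by (intro set_integral_mono int set_integrable_tail J psi0_ge tail_nonneg tail_le_1)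
qed

text \<open>Since |J| times the tail of J is at most |I| times the tail of I, the integrand is at
  most |I| / |J| times \<open>psi0\<close> of the tail of I, which is integrable because
  \<open>nstar\<close> of I is finite.\<close>

lemma set_integrable_cross:
  assumes I: "cell I" and J: "cell J" and sub: "J \<subseteq> I" and fin: "nstar M u I < \<infinity>"
  shows "set_integrable lborel {0<..} (\<lambda>t. tail M u J t * ln (1 / tail M u I t))"
proof (rule set_integrable_bound)
  note [measurable] = borel_measurable_tail[OF I] borel_measurable_tail[OF J]
  show "set_integrable lborel {0<..} (\<lambda>t. measure M I / measure M J * psi0 (tail M u I t))"
    by (intro set_integrable_mult_right set_integrable_psi0_tail I fin)
  show "set_borel_measurable lborel {0<..} (\<lambda>t. tail M u J t * ln (1 / tail M u I t))"
    unfolding set_borel_measurable_def by measurable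
  show "AE t in lborel. t \<in> {0<..} \<longrightarrow> norm (tail M u J t * ln (1 / tail M u I t))
      \<le> norm (measure M I / measure M J * psi0 (tail M u I t))"
  proof (intro AE_I2 impI)
    fix t :: real
    have "tail M u J t \<le> measure M I / measure M J * tail M u I t"
      using tail_subset[OF I J sub, of t] cell_pos[OF J] by (simp add: field_simps)
    then have "tail M u J t * ln (1 / tail M u I t)
        \<le> measure M I / measure M J * tail M u I t * ln (1 / tail M u I t)"
      by (intro mult_right_mono ln_tail_nonneg I)
    also have "\<dots> \<le> measure M I / measure M J * psi0 (tail M u I t)"
      unfolding mult.assoc by (intro mult_left_mono) (auto simp: psi0_eq)
    finally show "norm (tail M u J t * ln (1 / tail M u I t))
      \<le> norm (measure M I / measure M J * psi0 (tail M u I t))"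
      using ln_tail_nonneg[OF I, of t] psi0_tail_nonneg[OF I, of t] by (simp add: abs_mult)
  qed
qed

lemma cross_self:
  assumes "cell I" "nstar M u I < \<infinity>"
  shows "cross M u I I = ustar M u I - avg M u I"
proof -
  have "cross M u I I = (LBINT t:{0<..}. psi0 (tail M u I t) - tail M u I t)"
    unfolding cross_def by (simp add: psi0_eq)
  then show ?thesis
    using assms
    by (simp add: set_integral_diff set_integrable_psi0_tail set_integrable_tail set_integral_tail ustar_eq_integral)
qed

lemma cross_nonneg:
  assumes "cell I"
  shows "0 \<le> cross M u I J"
  unfolding cross_def set_lebesgue_integral_def
  by (intro integral_nonneg_AE AE_I2) (simp add: ln_tail_nonneg[OF assms])

text \<open>Both parts integrate \<open>psi0_Bregman\<close> over the level t, with s and S the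
  tails of J and I. The case l = 0 dominates \<open>psi0\<close> of the tail of J by an integrable
  function; general l gives the quantitative bound, since the averages of u differ by at most the L1
  distance of the tails.\<close>

lemma
  assumes I: "cell I" and J: "cell J" and sub: "J \<subseteq> I" and fin: "nstar M u I < \<infinity>"
  shows nstar_finite_subset: "nstar M u J < \<infinity>"
    and ustar_Bregman: "0 \<le> l \<Longrightarrow> l * \<bar>avg M u J - avg M u I\<bar> + ustar M u J
      \<le> cross M u I J + avg M u I + l\<^sup>2 / 2 * (avg M u J + avg M u I)"
proof -
  note [measurable] = borel_measurable_tail[OF I] borel_measurable_tail[OF J]
  let ?w = "\<lambda>t. tail M u J t * ln (1 / tail M u I t)"
  have w: "set_integrable lborel {0<..} ?w"
    by (rule set_integrable_cross[OF assms])
  have pointwise: "k * \<bar>tail M u J t - tail M u I t\<bar> + psi0 (tail M u J t)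
      \<le> ?w t + tail M u I t + k\<^sup>2 / 2 * (tail M u J t + tail M u I t)" if "0 \<le> k" for k t
    using that by (intro psi0_Bregman tail_nonneg tail_subset_eq_0[OF I J sub])
  have intJ: "set_integrable lborel {0<..} (\<lambda>t. psi0 (tail M u J t))"
  proof (rule set_integrable_bound)
    show "set_integrable lborel {0<..} (\<lambda>t. ?w t + tail M u I t)"
      by (intro set_integral_add w set_integrable_tail I)
    show "AE t in lborel. t \<in> {0<..} \<longrightarrow> norm (psi0 (tail M u J t)) \<le> norm (?w t + tail M u I t)"
      using pointwise[of 0] psi0_tail_nonneg[OF J]
      by (intro AE_I2 impI) (simp add: order_trans[OF _ abs_ge_self])
  qed (simp add: set_borel_measurable_def)
  then have "(\<integral>\<^sup>+t. ennreal (norm (indicator {0<..} t *\<^sub>R psi0 (tail M u J t))) \<partial>lborel) < \<infinity>"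
    unfolding set_integrable_def integrable_iff_bounded by simp
  moreover have "norm (indicator {0<..} t *\<^sub>R psi0 (tail M u J t)) = indicator {0<..} t *\<^sub>R psi0 (tail M u J t)" for t
    using psi0_tail_nonneg[OF J] by simp
  ultimately show finJ: "nstar M u J < \<infinity>"
    by (simp only: nstar_eq)
  assume l: "0 \<le> l"
  have tails: "set_integrable lborel {0<..} (tail M u J)" "set_integrable lborel {0<..} (tail M u I)"
    by (intro set_integrable_tail I J)+
  have diff: "set_integrable lborel {0<..} (\<lambda>t. tail M u J t - tail M u I t)"
    by (intro set_integral_diff tails)
  have "\<bar>avg M u J - avg M u I\<bar> = \<bar>LBINT t:{0<..}. tail M u J t - tail M u I t\<bar>"
    using tails by (simp add: set_integral_diff set_integral_tail I J)
  also have "\<dots> \<le> (LBINT t:{0<..}. \<bar>tail M u J t - tail M u I t\<bar>)"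
    using set_integral_norm_bound[OF diff] by simp
  finally have "l * \<bar>avg M u J - avg M u I\<bar> + ustar M u J
      \<le> l * (LBINT t:{0<..}. \<bar>tail M u J t - tail M u I t\<bar>) + ustar M u J"
    using l by (simp add: mult_left_mono)
  also have "\<dots> = (LBINT t:{0<..}. l * \<bar>tail M u J t - tail M u I t\<bar> + psi0 (tail M u J t))"
    using diff intJ by (simp add: set_integral_add set_integrable_abs ustar_eq_integral[OF J finJ])
  also have "\<dots> \<le> (LBINT t:{0<..}. ?w t + tail M u I t + l\<^sup>2 / 2 * (tail M u J t + tail M u I t))"
    by (intro set_integral_mono pointwise l set_integral_add set_integrable_mult_right
        set_integrable_abs w tails diff intJ)
  also have "\<dots> = cross M u I J + avg M u I + l\<^sup>2 / 2 * (avg M u J + avg M u I)"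
    using w tails by (simp add: set_integral_add cross_def set_integral_tail I J)
  finally show "l * \<bar>avg M u J - avg M u I\<bar> + ustar M u J
      \<le> cross M u I J + avg M u I + l\<^sup>2 / 2 * (avg M u J + avg M u I)" .
qed

lemma has_sum_cross:
  assumes I: "cell I" and fin: "nstar M u I < \<infinity>"
    and K: "countable K" "disjoint K" "\<And>J. J \<in> K \<Longrightarrow> cell J" and un: "\<Union>K = I"
  shows "((\<lambda>J. measure M J * cross M u I J) has_sum measure M I * cross M u I I) K"
proof -
  note [measurable] = borel_measurable_tail[OF I]
  \<comment> \<open>By Tonelli, |J| times \<open>cross M u I J\<close> is the integral of h over J
    for every cell J inside I, so additivity is that of the measure with density h.\<close>
  define h where "h x = (\<integral>\<^sup>+t. ennreal (ln (1 / tail M u I t)) * indicator {0<..<u x} t \<partial>lborel)" for x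
  have [measurable]: "h \<in> borel_measurable M"
    unfolding h_def [abs_def] indicator_def greaterThanLessThan_iff by measurable
  have eq: "emeasure (density M h) J = ennreal (measure M J * cross M u I J)"
    if J: "cell J" "J \<subseteq> I" for J
  proof -
    have "J \<in> sets M" using J by (simp add: cell_def)
    then have "emeasure (density M h) J = (\<integral>\<^sup>+x\<in>J. h x \<partial>M)"
      by (simp add: emeasure_density)
    also have "\<dots> = ennreal (measure M J) *
        (\<integral>\<^sup>+t\<in>{0<..}. ennreal (tail M u J t * ln (1 / tail M u I t)) \<partial>lborel)"
      unfolding h_def by (intro nn_integral_tail[symmetric] J ln_tail_nonneg I) measurable
    also have "(\<integral>\<^sup>+t\<in>{0<..}. ennreal (tail M u J t * ln (1 / tail M u I t)) \<partial>lborel) =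
        (\<integral>\<^sup>+t. ennreal (indicator {0<..} t *\<^sub>R (tail M u J t * ln (1 / tail M u I t))) \<partial>lborel)"
      by (intro nn_integral_cong) (simp add: indicator_def)
    also have "\<dots> = ennreal (cross M u I J)"
      unfolding cross_def set_lebesgue_integral_def
      using set_integrable_cross[OF I J fin] ln_tail_nonneg[OF I]
      by (intro nn_integral_eq_integral AE_I2) (simp_all add: set_integrable_def)
    finally show ?thesis
      by (simp add: ennreal_mult')
  qed
  have m: "measure (density M h) J = measure M J * cross M u I J" if "cell J" "J \<subseteq> I" for J
    using eq[OF that] cross_nonneg[OF I, of J] by (simp add: measure_def)
  have "(measure (density M h) has_sum measure (density M h) (\<Union>K)) K"
    using K eq[OF I] by (intro has_sum_measure_Union) (auto simp: un cell_def)
  moreover have "measure (density M h) J = measure M J * cross M u I J" if "J \<in> K" for J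
    using that K(3) un by (intro m) auto
  ultimately show ?thesis
    using has_sum_cong[of K "measure (density M h)" "\<lambda>J. measure M J * cross M u I J"
        "measure M I * cross M u I I"] m[OF I] by (simp add: un)
qed

end

subsection \<open>Increments over a partition of a cell\<close>

text \<open>With y = x / w - q one has x^2 / w = 2 q x - q^2 w + w y^2, and w y^2 >= l |y| w - l^2 w
  / 4. Thus x^2 / w exceeds its tangent plane, of slopes 2 q in x and - q^2 in w, by a gain linear
  in |x - q w|. All terms are linear so that they can be summed; q and l are chosen at each
  use.\<close>

lemma has_sum_quadratic:
  fixes p x w :: "'b \<Rightarrow> real"
  assumes p: "\<And>k. k \<in> K \<Longrightarrow> 0 \<le> p k" and w: "\<And>k. k \<in> K \<Longrightarrow> 0 \<le> w k"
    and x0: "\<And>k. k \<in> K \<Longrightarrow> w k = 0 \<Longrightarrow> x k = 0"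
    and X: "((\<lambda>k. p k * x k) has_sum X) K" and W: "((\<lambda>k. p k * w k) has_sum W) K"
    and S: "((\<lambda>k. p k * ((x k)\<^sup>2 / w k)) has_sum S) K"
    and A: "((\<lambda>k. p k * \<bar>x k - q * w k\<bar>) has_sum A) K"
  shows "l * A \<le> S - 2 * q * X + (q\<^sup>2 + l\<^sup>2 / 4) * W"
proof (rule has_sum_mono)
  show "((\<lambda>k. l * (p k * \<bar>x k - q * w k\<bar>)) has_sum l * A) K"
    by (rule has_sum_cmult_right[OF A])
  show "((\<lambda>k. p k * ((x k)\<^sup>2 / w k) - 2 * q * (p k * x k) + (q\<^sup>2 + l\<^sup>2 / 4) * (p k * w k))
      has_sum S - 2 * q * X + (q\<^sup>2 + l\<^sup>2 / 4) * W) K"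
    by (intro has_sum_add has_sum_diff has_sum_cmult_right X W S)
  fix k assume k: "k \<in> K"
  have "l * \<bar>x k - q * w k\<bar> \<le> (x k)\<^sup>2 / w k - 2 * q * x k + (q\<^sup>2 + l\<^sup>2 / 4) * w k"
  proof (cases "w k = 0")
    case False
    then have wk: "0 < w k" using w[OF k] by simp
    define y where "y = x k / w k - q"
    have x: "x k = (y + q) * w k"
      using wk by (simp add: y_def)
    have "0 \<le> w k * (\<bar>y\<bar> - l / 2)\<^sup>2"
      using wk by simp
    moreover have "\<bar>x k - q * w k\<bar> = \<bar>y\<bar> * w k"
      using wk by (simp add: x algebra_simps abs_mult)
    moreover have "(x k)\<^sup>2 / w k = (y + q)\<^sup>2 * w k"
      using wk by (simp add: x power2_eq_square)
    ultimately show ?thesis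
      by (simp add: x power2_eq_square algebra_simps flip: abs_mult)
  qed (use x0[OF k] in simp)
  from mult_left_mono[OF this p[OF k]]
  show "l * (p k * \<bar>x k - q * w k\<bar>)
      \<le> p k * ((x k)\<^sup>2 / w k) - 2 * q * (p k * x k) + (q\<^sup>2 + l\<^sup>2 / 4) * (p k * w k)"
    by (simp add: algebra_simps)
qed

context weight
begin

definition partition :: "'a set \<Rightarrow> 'a set set \<Rightarrow> bool" where
  "partition I K \<longleftrightarrow> cell I \<and> countable K \<and> disjoint K \<and> (\<forall>J\<in>K. cell J) \<and> \<Union>K = I"

text \<open>The normalized L1 norm of the martingale difference of g over the partition K, written
  as a sum over cells so that it makes sense for any K and not only for the children.\<close>

definition osc :: "('a \<Rightarrow> real) \<Rightarrow> 'a set \<Rightarrow> 'a set set \<Rightarrow> real" where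
  "osc g I K = (\<Sum>\<^sub>\<infinity>J\<in>K. measure M J * \<bar>avg M g J - avg M g I\<bar>) / measure M I"

lemma partition_cell: "partition I K \<Longrightarrow> cell I"
  and partition_cells: "partition I K \<Longrightarrow> J \<in> K \<Longrightarrow> cell J"
  and partition_subset: "partition I K \<Longrightarrow> J \<in> K \<Longrightarrow> J \<subseteq> I"
  by (auto simp: partition_def)

lemma has_sum_measure:
  assumes "partition I K"
  shows "(measure M has_sum measure M I) K"
  using has_sum_measure_Union[of K M] assms by (auto simp: partition_def cell_def subset_eq)

lemma measure_mult_avg: "cell J \<Longrightarrow> measure M J * avg M g J = (LINT x:J|M. g x)"
  using cell_pos[of J] by (simp add: avg_def)

lemma has_sum_avg:
  assumes P: "partition I K" and g: "set_integrable M I g"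
  shows "((\<lambda>J. measure M J * avg M g J) has_sum measure M I * avg M g I) K"
proof -
  have "((\<lambda>J. LINT x:J|M. g x) has_sum (LINT x:\<Union>K|M. g x)) K"
    using P g by (intro has_sum_set_integral) (auto simp: partition_def cell_def)
  moreover have "measure M J * avg M g J = (LINT x:J|M. g x)" if "J \<in> K" for J
    using measure_mult_avg partition_cells[OF P that] by blast
  moreover have "measure M I * avg M g I = (LINT x:\<Union>K|M. g x)"
    using P measure_mult_avg[of I g] by (simp add: partition_def)
  ultimately show ?thesis
    using has_sum_cong[of K "\<lambda>J. LINT x:J|M. g x" "\<lambda>J. measure M J * avg M g J"] by simp
qed

lemma has_sum_osc:
  assumes P: "partition I K" and g: "set_integrable M I g"
  shows "((\<lambda>J. measure M J * \<bar>avg M g J - avg M g I\<bar>) has_sum measure M I * osc g I K) K"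
proof -
  have "((\<lambda>J. measure M J * avg M g J - measure M J * avg M g I) has_sum
      measure M I * avg M g I - measure M I * avg M g I) K"
    by (intro has_sum_diff has_sum_avg[OF P g] has_sum_cmult_left has_sum_measure[OF P])
  then have "(\<lambda>J. \<bar>measure M J * avg M g J - measure M J * avg M g I\<bar>) summable_on K"
    using has_sum_imp_summable summable_on_iff_abs_summable_on_real by fastforce
  moreover have "\<bar>measure M J * avg M g J - measure M J * avg M g I\<bar> = measure M J * \<bar>avg M g J - avg M g I\<bar>" for J
    by (simp add: abs_mult flip: right_diff_distrib)
  ultimately show ?thesis
    using cell_pos[OF partition_cell[OF P]] by (simp add: osc_def)
qed

lemma avg_eq_0_subset:
  assumes P: "partition I K" and J: "J \<in> K" and u: "avg M u I = 0"
  shows "avg M u J = 0"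
proof -
  have "set_integrable M I u"
    using P by (simp add: partition_def cell_def)
  then have "((\<lambda>J. measure M J * avg M u J) has_sum 0) K"
    using has_sum_avg[OF P, of u] u by simp
  moreover have "0 \<le> measure M J * avg M u J" if "J \<in> K" for J
    using avg_nonneg[of J] partition_cells[OF P that] by (simp add: cell_def)
  ultimately have "measure M J * avg M u J = 0"
    using J nonneg_has_sum_le_0D[of "\<lambda>J. measure M J * avg M u J" K 0 J] by simp
  then show ?thesis
    using cell_pos[OF partition_cells[OF P J]] by simp
qed

text \<open>\<open>ustar_Bregman\<close> is summed over K. The cross terms and the averages add up
  exactly, and by \<open>cross_self\<close> they reproduce \<open>ustar\<close> of I; what remains
  is the drop l osc - l^2 u_I.\<close>

lemma ustar_supermartingale:
  assumes P: "partition I K" and fin: "nstar M u I < \<infinity>" and pos: "0 < avg M u I"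
  obtains S where "((\<lambda>J. measure M J * ustar M u J) has_sum S) K"
    "S \<le> measure M I * (ustar M u I - (osc u I K)\<^sup>2 / (4 * avg M u I))"
proof -
  let ?m = "measure M" and ?u = "avg M u"
  have I: "cell I" and u: "set_integrable M I u"
    using P by (auto simp: partition_def cell_def)
  \<comment> \<open>This l maximizes l osc - l^2 u_I, with maximum osc^2 / (4 u_I).\<close>
  define l where "l = osc u I K / (2 * ?u I)"
  have osc: "0 \<le> osc u I K"
    unfolding osc_def by (intro divide_nonneg_nonneg infsum_nonneg) auto
  then have l: "0 \<le> l"
    using pos by (simp add: l_def)
  let ?r = "\<lambda>J. ?m J * cross M u I J + ?m J * ?u I + l\<^sup>2 / 2 * (?m J * ?u J + ?m J * ?u I)"
  let ?o = "\<lambda>J. l * (?m J * \<bar>?u J - ?u I\<bar>)"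
  have r: "(?r has_sum ?m I * cross M u I I + ?m I * ?u I + l\<^sup>2 / 2 * (?m I * ?u I + ?m I * ?u I)) K"
    using P by (intro has_sum_add has_sum_cmult_right has_sum_cmult_left has_sum_cross
        has_sum_measure[OF P] has_sum_avg[OF P] u fin I) (auto simp: partition_def)
  have o: "(?o has_sum l * (?m I * osc u I K)) K"
    by (intro has_sum_cmult_right has_sum_osc P u)
  have le: "?o J + ?m J * ustar M u J \<le> ?r J" if "J \<in> K" for J
  proof -
    have "l * \<bar>?u J - ?u I\<bar> + ustar M u J \<le> cross M u I J + ?u I + l\<^sup>2 / 2 * (?u J + ?u I)"
      by (rule ustar_Bregman[OF I partition_cells[OF P that] partition_subset[OF P that] fin l])
    from mult_left_mono[OF this, of "?m J"] show ?thesis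
      by (simp add: algebra_simps add_divide_distrib)
  qed
  have ustar: "0 \<le> ustar M u J" for J
    by (simp add: ustar_eq)
  have "(\<lambda>J. ?m J * ustar M u J) summable_on K"
  proof (rule summable_on_comparison_test[OF has_sum_imp_summable[OF r]])
    fix J assume "J \<in> K"
    have "0 \<le> ?o J" using l by simp
    then show "?m J * ustar M u J \<le> ?r J"
      using le[OF \<open>J \<in> K\<close>] by linarith
  qed (simp add: ustar)
  then obtain S where S: "((\<lambda>J. ?m J * ustar M u J) has_sum S) K"
    by (auto simp: summable_on_def)
  have "l * (?m I * osc u I K) + S
      \<le> ?m I * cross M u I I + ?m I * ?u I + l\<^sup>2 / 2 * (?m I * ?u I + ?m I * ?u I)"
    by (rule has_sum_mono[OF has_sum_add[OF o S] r le])
  also have "\<dots> = ?m I * (ustar M u I + l\<^sup>2 * ?u I)"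
    by (simp add: cross_self[OF I fin] algebra_simps)
  finally have "S \<le> ?m I * (ustar M u I + l\<^sup>2 * ?u I - l * osc u I K)"
    by (simp add: algebra_simps)
  also have "l\<^sup>2 * ?u I - l * osc u I K = - ((osc u I K)\<^sup>2 / (4 * ?u I))"
    using pos by (simp add: l_def power2_eq_square field_simps)
  then have "ustar M u I + l\<^sup>2 * ?u I - l * osc u I K = ustar M u I - (osc u I K)\<^sup>2 / (4 * ?u I)"
    by linarith
  finally show ?thesis
    using that S by blast
qed

end

section \<open>The concave function \<open>phi\<close> and the potential \<open>pot\<close>\<close>

locale bump = weight M u for M :: "'a measure" and u +
  fixes \<alpha> :: "real \<Rightarrow> real"
  assumes alpha_pos: "\<And>t. 1 \<le> t \<Longrightarrow> 0 < \<alpha> t"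
    and alpha_mono: "mono_on {1..} \<alpha>"
    and alpha_int: "set_integrable lborel {1..} (\<lambda>t. 1 / (t * \<alpha> t))"
begin

definition phi :: "real \<Rightarrow> real" where
  "phi s = (LBINT t:{1..s}. 1 / (t * \<alpha> t))"

definition phi_top :: real where
  "phi_top = (LBINT t:{1..}. 1 / (t * \<alpha> t))"

lemma alpha_nonneg: "1 \<le> t \<Longrightarrow> 0 \<le> 1 / (t * \<alpha> t)"
  using alpha_pos[of t] by simp

lemma phi_int: "A \<in> sets lborel \<Longrightarrow> A \<subseteq> {1..} \<Longrightarrow> set_integrable lborel A (\<lambda>t. 1 / (t * \<alpha> t))"
  using alpha_int by (rule set_integrable_subset)

lemma phi_nonneg: "0 \<le> phi s"
  unfolding phi_def set_lebesgue_integral_def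
  using alpha_nonneg by (intro integral_nonneg_AE AE_I2) (auto simp: indicator_def)

lemma phi_le_top: "phi s \<le> phi_top"
  unfolding phi_def phi_top_def set_lebesgue_integral_def
proof (rule integral_mono)
  show "indicator {1..s} t *\<^sub>R (1 / (t * \<alpha> t)) \<le> indicator {1..} t *\<^sub>R (1 / (t * \<alpha> t))" for t
    using alpha_nonneg[of t] by (auto simp: indicator_def)
qed (use phi_int[of "{1..s}"] alpha_int in \<open>auto simp: set_integrable_def\<close>)

lemma phi_add:
  assumes "1 \<le> s" "s \<le> t"
  shows "phi t = phi s + (LBINT t:{s<..t}. 1 / (t * \<alpha> t))"
proof -
  have "{1..t} = {1..s} \<union> {s<..t}"
    using assms by auto
  moreover have "set_integrable lborel {1..s} (\<lambda>t. 1 / (t * \<alpha> t))"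
    "set_integrable lborel {s<..t} (\<lambda>t. 1 / (t * \<alpha> t))"
    using assms by (auto intro!: phi_int)
  ultimately show ?thesis
    unfolding phi_def by (simp only: set_integral_Un ivl_disj_int)
qed

text \<open>The integrand 1 / (t \<alpha> t) decreases, so its value at s bounds it from above to
  the right of s and from below to the left. As \<alpha> may jump, \<open>phi\<close> need not be
  differentiable, and this supergradient inequality takes the place of a derivative.\<close>

lemma phi_concave:
  assumes s: "1 \<le> s" and t: "1 \<le> t"
  shows "phi t \<le> phi s + (t - s) / (s * \<alpha> s)"
proof -
  have anti: "1 / (y * \<alpha> y) \<le> 1 / (x * \<alpha> x)" if "1 \<le> x" "x \<le> y" for x y
  proof (rule divide_left_mono)
    have "\<alpha> x \<le> \<alpha> y"
      using that by (intro mono_onD[OF alpha_mono]) auto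
    then show "x * \<alpha> x \<le> y * \<alpha> y"
      using that alpha_pos[of x] by (intro mult_mono) auto
    show "0 < y * \<alpha> y * (x * \<alpha> x)"
      using that alpha_pos[of x] alpha_pos[of y] by simp
  qed simp
  have const: "(LBINT r:{x<..y}. c) = (y - x) * c" "set_integrable lborel {x<..y} (\<lambda>r. c)"
    if "x \<le> y" for x y c :: real
    using that by (simp_all add: set_integrable_def set_lebesgue_integral_def)
  show ?thesis
  proof (cases "s \<le> t")
    case True
    have "(LBINT r:{s<..t}. 1 / (r * \<alpha> r)) \<le> (LBINT r:{s<..t}. 1 / (s * \<alpha> s))"
      using s True by (intro set_integral_mono phi_int const anti) auto
    then show ?thesis
      using phi_add[OF s True] True by (simp add: const)
  next
    case False
    have "(LBINT r:{t<..s}. 1 / (s * \<alpha> s)) \<le> (LBINT r:{t<..s}. 1 / (r * \<alpha> r))"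
      using t False by (intro set_integral_mono phi_int const anti) auto
    then show ?thesis
      using phi_add[of t s] t False by (simp add: const diff_divide_distrib)
  qed
qed

text \<open>Where \<open>nstar\<close> is infinite, \<open>ustar\<close> is 0 and so would be
  \<open>phi\<close> of the quotient; the value \<open>phi_top\<close> of \<open>phi\<close> at
  infinity is therefore put in by hand. It dominates the potential of all children.\<close>

definition pot :: "'a set \<Rightarrow> real" where
  "pot I = avg M u I * (if nstar M u I = \<infinity> then phi_top else phi (ustar M u I / avg M u I))"

lemma phi_top_nonneg: "0 \<le> phi_top"
  using phi_nonneg phi_le_top order_trans by blast

lemma pot_nonneg: "cell I \<Longrightarrow> 0 \<le> pot I"
  unfolding pot_def by (intro mult_nonneg_nonneg avg_nonneg) (simp_all add: cell_def phi_nonneg phi_top_nonneg)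

lemma pot_le: "cell I \<Longrightarrow> pot I \<le> avg M u I * phi_top"
  unfolding pot_def by (intro mult_left_mono avg_nonneg) (simp_all add: cell_def phi_le_top)

text \<open>As a function of the pair (average, \<open>ustar\<close>), the potential is the
  perspective of the concave \<open>phi\<close>, so \<open>phi_concave\<close> at N becomes a
  tangent plane at the pair of I. The bound is linear in the pair of J and can be summed; its slope
  1 / (N \<alpha> N) in \<open>ustar\<close> is the factor that passes on the drop of
  \<open>ustar\<close>.\<close>

lemma pot_le_tangent:
  assumes I: "cell I" "nstar M u I < \<infinity>" "0 < avg M u I" and J: "cell J" "nstar M u J < \<infinity>"
  defines "N \<equiv> ustar M u I / avg M u I"
  shows "pot J \<le> avg M u J * phi N + (ustar M u J - N * avg M u J) / (N * \<alpha> N)"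
proof -
  have N: "1 \<le> N"
    using avg_le_ustar[OF I(1,2)] I(3) by (simp add: N_def)
  show ?thesis
  proof (cases "avg M u J = 0")
    case True
    have "0 \<le> ustar M u J / (N * \<alpha> N)"
      using N alpha_pos[OF N] by (simp add: ustar_eq)
    then show ?thesis using True by (simp add: pot_def)
  next
    case False
    then have J0: "0 < avg M u J"
      using avg_nonneg[of J] J by (simp add: cell_def)
    have "phi (ustar M u J / avg M u J) \<le> phi N + (ustar M u J / avg M u J - N) / (N * \<alpha> N)"
      using N J0 avg_le_ustar[OF J] by (intro phi_concave) auto
    then have "avg M u J * phi (ustar M u J / avg M u J)
        \<le> avg M u J * (phi N + (ustar M u J / avg M u J - N) / (N * \<alpha> N))"
      using J0 by (intro mult_left_mono) auto
    also have "\<dots> = avg M u J * phi N + (ustar M u J - N * avg M u J) / (N * \<alpha> N)"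
      using J0 N alpha_pos[OF N] by (simp add: field_simps)
    finally show ?thesis
      using J(2) by (auto simp: pot_def)
  qed
qed

lemma pot_supermartingale:
  assumes P: "partition I K"
  obtains S where "((\<lambda>J. measure M J * pot J) has_sum S) K"
    "S \<le> measure M I *
      (pot I - (osc u I K)\<^sup>2 / (4 * (\<alpha> (ustar M u I / avg M u I) * ustar M u I)))"
proof -
  let ?m = "measure M" and ?u = "avg M u"
  note I = partition_cell[OF P]
  have u: "set_integrable M I u"
    using I by (simp add: cell_def)
  define N where "N = ustar M u I / ?u I"
  have "(\<lambda>J. phi_top * (?m J * ?u J)) summable_on K"
    by (intro summable_on_cmult_right has_sum_imp_summable[OF has_sum_avg[OF P u]])
  then have "(\<lambda>J. ?m J * pot J) summable_on K"
  proof (rule summable_on_comparison_test)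
    fix J assume "J \<in> K"
    note J = partition_cells[OF P this]
    show "?m J * pot J \<le> phi_top * (?m J * ?u J)"
      using mult_left_mono[OF pot_le[OF J], of "?m J"] by (simp add: mult_ac)
    show "0 \<le> ?m J * pot J"
      using pot_nonneg[OF J] by simp
  qed
  then obtain S where S: "((\<lambda>J. ?m J * pot J) has_sum S) K"
    by (auto simp: summable_on_def)
  \<comment> \<open>If \<open>nstar\<close> is infinite, \<open>ustar\<close> is 0 and the quotient
    is a division by zero, hence 0; \<open>pot_le\<close> then suffices. If u_I = 0, everything
    vanishes on the children. The remaining case uses tangents.\<close>
  consider "nstar M u I = \<infinity>" | "?u I = 0" "ustar M u I \<noteq> 0 \<Longrightarrow> nstar M u I < \<infinity>"
    | "nstar M u I < \<infinity>" "0 < ?u I"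
    using avg_nonneg[of I] I by (fastforce simp: cell_def ustar_eq less_top)
  then have "S \<le> ?m I * (pot I - (osc u I K)\<^sup>2 / (4 * (\<alpha> N * ustar M u I)))"
  proof cases
    case 1
    have "S \<le> phi_top * (?m I * ?u I)"
    proof (rule has_sum_mono[OF S has_sum_cmult_right[OF has_sum_avg[OF P u]]])
      fix J assume "J \<in> K"
      show "?m J * pot J \<le> phi_top * (?m J * ?u J)"
        using mult_left_mono[OF pot_le[OF partition_cells[OF P \<open>J \<in> K\<close>]], of "?m J"]
        by (simp add: mult_ac)
    qed
    then show ?thesis
      using 1 by (simp add: pot_def ustar_eq mult_ac)
  next
    case 2
    have 0: "?u J = 0" if "J \<in> K" for J
      using avg_eq_0_subset[OF P that] 2 by simp
    then have "((\<lambda>J. ?m J * pot J) has_sum 0) K"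
      by (intro has_sum_0) (simp add: pot_def)
    then have "S = 0"
      using S has_sum_unique by blast
    moreover have "osc u I K = 0"
      unfolding osc_def using 0 2 by (simp cong: infsum_cong)
    ultimately show ?thesis
      using 2 by (simp add: pot_def)
  next
    case 3
    have N1: "1 \<le> N" and N: "N * ?u I = ustar M u I"
      using avg_le_ustar[OF I] 3 by (simp_all add: N_def)
    obtain T where T: "((\<lambda>J. ?m J * ustar M u J) has_sum T) K"
      "T \<le> ?m I * (ustar M u I - (osc u I K)\<^sup>2 / (4 * ?u I))"
      using ustar_supermartingale[OF P 3] .
    have "S \<le> phi N * (?m I * ?u I) + (T - N * (?m I * ?u I)) / (N * \<alpha> N)"
    proof (rule has_sum_mono[OF S])
      show "((\<lambda>J. phi N * (?m J * ?u J) + (?m J * ustar M u J - N * (?m J * ?u J)) / (N * \<alpha> N))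
          has_sum phi N * (?m I * ?u I) + (T - N * (?m I * ?u I)) / (N * \<alpha> N)) K"
        by (intro has_sum_add has_sum_cmult_right has_sum_diff has_sum_divide_const has_sum_avg P u T)
      fix J assume J: "J \<in> K"
      have "pot J \<le> ?u J * phi N + (ustar M u J - N * ?u J) / (N * \<alpha> N)"
        unfolding N_def
        by (rule pot_le_tangent[OF I 3 partition_cells[OF P J]
              nstar_finite_subset[OF I partition_cells[OF P J] partition_subset[OF P J] 3(1)]])
      from mult_left_mono[OF this, of "?m J"]
      show "?m J * pot J \<le> phi N * (?m J * ?u J) + (?m J * ustar M u J - N * (?m J * ?u J)) / (N * \<alpha> N)"
        using N1 by (simp add: algebra_simps diff_divide_distrib)
    qed
    \<comment> \<open>The slope 1 / (N \<alpha> N) times the drop osc^2 / (4 u_I) is the claimed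
      drop, because N u_I = \<open>ustar\<close> of I.\<close>
    also have "\<dots> \<le> phi N * (?m I * ?u I) +
        (?m I * (ustar M u I - (osc u I K)\<^sup>2 / (4 * ?u I)) - N * (?m I * ?u I)) / (N * \<alpha> N)"
      using T(2) N1 alpha_pos[OF N1] by (intro add_left_mono divide_right_mono diff_right_mono) auto
    also have "\<dots> = ?m I * (pot I - (osc u I K)\<^sup>2 / (4 * (\<alpha> N * (N * ?u I))))"
      using 3(2) less_imp_neq[OF 3(1)] N1 alpha_pos[OF N1] unfolding pot_def
      by (simp add: N_def[symmetric] N[symmetric] field_simps)
    finally show ?thesis
      unfolding N .
  qed
  then show ?thesis
    using that[OF S] by (simp add: N_def)
qed

end

section \<open>The function \<open>Bell\<close> and its gain over one partition\<close>

lemma has_sum_abs_exists: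
  fixes f :: "'b \<Rightarrow> real"
  assumes "(f has_sum s) K"
  shows "\<exists>A. ((\<lambda>k. \<bar>f k\<bar>) has_sum A) K"
  using assms has_sum_imp_summable summable_on_iff_abs_summable_on_real summable_on_def by fastforce

locale bump_fun = bump M u \<alpha> for M :: "'a measure" and u \<alpha> +
  fixes f :: "'a \<Rightarrow> real"
  assumes f_meas [measurable]: "f \<in> borel_measurable M"
    and f_L2: "integrable M (\<lambda>x. (f x)\<^sup>2 * u x)"
begin

abbreviation "fu \<equiv> \<lambda>x. f x * u x"
abbreviation "ffu \<equiv> \<lambda>x. (f x)\<^sup>2 * u x"

definition C where "C = 1 / \<alpha> 1 + phi_top"

text \<open>The first term pays for the part of fu not proportional to u, the second for the
  oscillation of u. The factor 2 is that of (a + b)^2 <= 2 a^2 + 2 b^2; 32 = 2 * 4 * 4 collects this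
  2, the 4 of q^2 <= 4 C^2 p^2 and the 4 in the drop of \<open>pot\<close>.\<close>

definition Bell :: "'a set \<Rightarrow> real" where
  "Bell I = 2 / \<alpha> 1 * ((avg M fu I)\<^sup>2 / avg M u I)
    + 32 * C\<^sup>2 * ((avg M fu I)\<^sup>2 / (C * avg M u I + pot I))"

lemma C_pos: "0 < C"
  using alpha_pos[of 1] phi_top_nonneg by (simp add: C_def add_pos_nonneg)

lemma inverse_alpha_le_C: "1 / \<alpha> 1 \<le> C"
  using phi_top_nonneg by (simp add: C_def)

lemma pot_le_C:
  assumes J: "cell J"
  shows "pot J \<le> C * avg M u J"
proof -
  have "avg M u J * phi_top \<le> avg M u J * C"
    using J alpha_pos[of 1] by (intro mult_left_mono avg_nonneg) (simp_all add: cell_def C_def)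
  then show ?thesis
    using pot_le[OF J] by (simp add: mult.commute)
qed

lemma set_integrable_ffu: "J \<in> sets M \<Longrightarrow> set_integrable M J ffu"
  using integrable_mult_indicator[OF _ f_L2] by (simp add: set_integrable_def)

lemma set_integrable_fu:
  assumes "cell J"
  shows "set_integrable M J fu"
proof (rule set_integrable_bound)
  have J: "J \<in> sets M" "set_integrable M J u"
    using assms by (auto simp: cell_def)
  show "set_integrable M J (\<lambda>x. ffu x + u x)"
    by (intro set_integral_add set_integrable_ffu J)
  show "set_borel_measurable M J fu"
    unfolding set_borel_measurable_def using J(1) by measurable
  show "AE x in M. x \<in> J \<longrightarrow> norm (fu x) \<le> norm (ffu x + u x)"
  proof (intro AE_I2 impI)
    fix x assume x: "x \<in> space M"
    have "0 \<le> (\<bar>f x\<bar> - 1)\<^sup>2" by simp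
    then have "2 * \<bar>f x\<bar> \<le> (f x)\<^sup>2 + 1"
      by (simp add: power2_eq_square algebra_simps)
    moreover have "0 \<le> \<bar>f x\<bar>" by simp
    ultimately have "\<bar>f x\<bar> \<le> (f x)\<^sup>2 + 1"
      by linarith
    then have "\<bar>f x\<bar> * u x \<le> ((f x)\<^sup>2 + 1) * u x"
      using u_nonneg[OF x] by (intro mult_right_mono)
    then show "norm (fu x) \<le> norm (ffu x + u x)"
      using u_nonneg[OF x] by (simp add: abs_mult algebra_simps)
  qed
qed

text \<open>The mean of u (f - q)^2 is nonnegative: Cauchy-Schwarz with a free parameter q, a form
  that also says something on cells where the average of u is 0.\<close>

lemma avg_fu_le:
  assumes J: "cell J"
  shows "2 * q * avg M fu J \<le> avg M ffu J + q\<^sup>2 * avg M u J"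
proof -
  have sets: "J \<in> sets M" "set_integrable M J u"
    using J by (auto simp: cell_def)
  have "(LINT x:J|M. 2 * q * fu x) \<le> (LINT x:J|M. ffu x + q\<^sup>2 * u x)"
  proof (rule set_integral_mono)
    show "set_integrable M J (\<lambda>x. 2 * q * fu x)"
      by (intro set_integrable_mult_right set_integrable_fu J)
    show "set_integrable M J (\<lambda>x. ffu x + q\<^sup>2 * u x)"
      by (intro set_integral_add set_integrable_mult_right set_integrable_ffu sets)
    fix x assume "x \<in> J"
    then have "0 \<le> u x * (f x - q)\<^sup>2"
      using u_nonneg sets.sets_into_space[OF sets(1)] by auto
    then show "2 * q * fu x \<le> ffu x + q\<^sup>2 * u x"
      by (simp add: power2_eq_square algebra_simps)
  qed
  also have "\<dots> = (LINT x:J|M. ffu x) + q\<^sup>2 * (LINT x:J|M. u x)"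
    using sets set_integrable_ffu[of J] by (simp add: set_integral_add)
  finally show ?thesis
    using cell_pos[OF J] by (simp add: avg_def divide_simps)
qed

lemma avg_fu_eq_0:
  assumes J: "cell J" and u: "avg M u J = 0"
  shows "avg M fu J = 0"
proof (rule ccontr)
  assume x: "avg M fu J \<noteq> 0"
  \<comment> \<open>With u_J = 0 the bound holds for all q; this q makes its left side the average
    of f^2 u plus 1.\<close>
  have "2 * ((avg M ffu J + 1) / (2 * avg M fu J)) * avg M fu J \<le> avg M ffu J"
    using avg_fu_le[OF J, of "(avg M ffu J + 1) / (2 * avg M fu J)"] u by simp
  then show False
    using x by simp
qed

lemma avg_fu_square_le:
  assumes J: "cell J"
  shows "(avg M fu J)\<^sup>2 / avg M u J \<le> avg M ffu J"
proof (cases "avg M u J = 0")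
  case True
  then show ?thesis
    using avg_fu_le[OF J, of 0] by simp
next
  case False
  then have "(avg M fu J / avg M u J)\<^sup>2 * avg M u J = (avg M fu J)\<^sup>2 / avg M u J"
    "2 * (avg M fu J / avg M u J) * avg M fu J = 2 * ((avg M fu J)\<^sup>2 / avg M u J)"
    by (simp_all add: power2_eq_square)
  then show ?thesis
    using avg_fu_le[OF J, of "avg M fu J / avg M u J"] by linarith
qed

lemma Bell_nonneg: "cell J \<Longrightarrow> 0 \<le> Bell J"
  unfolding Bell_def using C_pos alpha_pos[of 1] pot_nonneg[of J] avg_nonneg[of J]
  by (intro add_nonneg_nonneg mult_nonneg_nonneg divide_nonneg_nonneg) (auto simp: cell_def)

lemma fu_square_div_le:
  assumes J: "cell J"
  shows "(avg M fu J)\<^sup>2 / (C * avg M u J + pot J) \<le> (avg M fu J)\<^sup>2 / (C * avg M u J)"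
proof (cases "avg M u J = 0")
  case True
  then show ?thesis using avg_fu_eq_0[OF J] by simp
next
  case False
  then have "0 < avg M u J"
    using avg_nonneg[of J] J by (simp add: cell_def)
  then show ?thesis
    using C_pos pot_nonneg[OF J] by (intro divide_left_mono) (auto intro!: mult_pos_pos add_pos_nonneg)
qed

text \<open>As \<open>pot\<close> is nonnegative, the second term of \<open>Bell\<close> is at most
  32 C x^2 / u; as 1 / \<alpha> 1 <= C, the first is at most 2 C x^2 / u. Cauchy-Schwarz does the
  rest.\<close>

lemma Bell_le:
  assumes J: "cell J"
  shows "Bell J \<le> 34 * C * avg M ffu J"
proof -
  have "32 * C\<^sup>2 * ((avg M fu J)\<^sup>2 / (C * avg M u J + pot J))
      \<le> 32 * C\<^sup>2 * ((avg M fu J)\<^sup>2 / (C * avg M u J))"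
    by (intro mult_left_mono fu_square_div_le J) simp
  also have "\<dots> = 32 * C * ((avg M fu J)\<^sup>2 / avg M u J)"
    using C_pos by (simp add: power2_eq_square)
  also have "\<dots> \<le> 32 * C * avg M ffu J"
    using C_pos by (intro mult_left_mono avg_fu_square_le J) simp
  moreover have "2 / \<alpha> 1 * ((avg M fu J)\<^sup>2 / avg M u J) \<le> 2 * C * avg M ffu J"
    using avg_fu_square_le[OF J] inverse_alpha_le_C C_pos avg_nonneg[of J] J
    by (intro mult_mono divide_nonneg_nonneg) (auto simp: cell_def)
  ultimately show ?thesis
    by (simp add: Bell_def)
qed

text \<open>Where \<open>nstar\<close> is finite, u_I is at most \<open>ustar\<close> and \<alpha>
  is increasing. The alternative d = 0 is the infinite case, in which \<open>ustar\<close> is 0 and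
  quotients by d are 0.\<close>

lemma denominator_ge:
  assumes I: "cell I" and uI: "0 < avg M u I"
  defines "d \<equiv> \<alpha> (ustar M u I / avg M u I) * ustar M u I"
  shows "d = 0 \<or> avg M u I * \<alpha> 1 \<le> d"
proof (cases "nstar M u I < \<infinity>")
  case True
  define N where "N = ustar M u I / avg M u I"
  have le: "avg M u I \<le> ustar M u I"
    by (rule avg_le_ustar[OF I True])
  then have "1 \<le> N"
    using uI by (simp add: N_def)
  then have "\<alpha> 1 \<le> \<alpha> N"
    by (intro mono_onD[OF alpha_mono]) auto
  then have "\<alpha> 1 * avg M u I \<le> \<alpha> N * ustar M u I"
    using le uI alpha_pos[of 1] by (intro mult_mono) auto
  then show ?thesis
    by (simp add: d_def N_def mult.commute)
next
  case False
  then have "nstar M u I = \<infinity>"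
    by (simp flip: less_top)
  then show ?thesis
    by (simp add: d_def ustar_eq)
qed

lemma osc_fu_eq_0:
  assumes P: "partition I K" and u: "avg M u I = 0"
  shows "osc fu I K = 0"
proof -
  have "avg M fu I = 0"
    by (rule avg_fu_eq_0[OF partition_cell[OF P] u])
  moreover have "avg M fu J = 0" if "J \<in> K" for J
    using avg_fu_eq_0[OF partition_cells[OF P that] avg_eq_0_subset[OF P that u]] .
  ultimately show ?thesis
    unfolding osc_def by (simp cong: infsum_cong)
qed

text \<open>Two gains are produced: \<open>gap1\<close> from the strict convexity of x^2 / u along
  non-proportional increments, \<open>gap2\<close> from the drop of \<open>pot\<close> inside x^2 /
  (C u + pot). They pay for the parts a and |q| osc u of osc fu respectively.\<close>

lemma Bell_submartingale:
  assumes P: "partition I K"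
  obtains S where "((\<lambda>J. measure M J * Bell J) has_sum S) K"
    "measure M I * Bell I
      + (osc fu I K)\<^sup>2 * measure M I / (\<alpha> (ustar M u I / avg M u I) * ustar M u I) \<le> S"
proof -
  let ?m = "measure M" and ?u = "avg M u" and ?x = "avg M fu"
  note I = partition_cell[OF P] and K = partition_cells[OF P]
  have u: "set_integrable M I u" and sets: "I \<in> sets M"
    using I by (auto simp: cell_def)
  define w where "w J = C * ?u J + pot J" for J
  define d where "d = \<alpha> (ustar M u I / ?u I) * ustar M u I"
  have u0: "0 \<le> ?u J" if "cell J" for J
    using avg_nonneg[of J] that by (simp add: cell_def)
  have w0: "0 \<le> w J" if "cell J" for J
    using that C_pos u0 pot_nonneg by (simp add: w_def)
  have m: "0 < ?m I"
    by (rule cell_pos[OF I])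
  have sum_u: "((\<lambda>J. ?m J * ?u J) has_sum ?m I * ?u I) K"
    and sum_x: "((\<lambda>J. ?m J * ?x J) has_sum ?m I * ?x I) K"
    and sum_ff: "((\<lambda>J. ?m J * avg M ffu J) has_sum ?m I * avg M ffu I) K"
    by (intro has_sum_avg P u set_integrable_fu I set_integrable_ffu sets)+
  obtain Mp where Mp: "((\<lambda>J. ?m J * pot J) has_sum Mp) K"
    "Mp \<le> ?m I * (pot I - (osc u I K)\<^sup>2 / (4 * d))"
    using pot_supermartingale[OF P] unfolding d_def .
  have sum_w: "((\<lambda>J. ?m J * w J) has_sum C * (?m I * ?u I) + Mp) K"
    using has_sum_add[OF has_sum_cmult_right[OF sum_u, of C] Mp(1)] by (simp add: w_def algebra_simps)
  have "(\<lambda>J. ?m J * ((?x J)\<^sup>2 / ?u J)) summable_on K"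
  proof (rule summable_on_comparison_test[OF has_sum_imp_summable[OF sum_ff]])
    fix J assume J: "J \<in> K"
    show "?m J * ((?x J)\<^sup>2 / ?u J) \<le> ?m J * avg M ffu J"
      by (intro mult_left_mono avg_fu_square_le K J) simp
    show "0 \<le> ?m J * ((?x J)\<^sup>2 / ?u J)"
      using u0[OF K[OF J]] by simp
  qed
  then obtain S1 where S1: "((\<lambda>J. ?m J * ((?x J)\<^sup>2 / ?u J)) has_sum S1) K"
    by (auto simp: summable_on_def)
  have "(\<lambda>J. 1 / C * (?m J * ((?x J)\<^sup>2 / ?u J))) summable_on K"
    by (intro summable_on_cmult_right has_sum_imp_summable[OF S1])
  then have "(\<lambda>J. ?m J * ((?x J)\<^sup>2 / w J)) summable_on K"
  proof (rule summable_on_comparison_test)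
    fix J assume J: "J \<in> K"
    show "?m J * ((?x J)\<^sup>2 / w J) \<le> 1 / C * (?m J * ((?x J)\<^sup>2 / ?u J))"
      using mult_left_mono[OF fu_square_div_le[OF K[OF J]], of "?m J"] by (simp add: w_def field_simps)
    show "0 \<le> ?m J * ((?x J)\<^sup>2 / w J)"
      using w0[OF K[OF J]] by simp
  qed
  then obtain S2 where S2: "((\<lambda>J. ?m J * ((?x J)\<^sup>2 / w J)) has_sum S2) K"
    by (auto simp: summable_on_def)
  have sum_B: "((\<lambda>J. ?m J * Bell J) has_sum 2 / \<alpha> 1 * S1 + 32 * C\<^sup>2 * S2) K"
    using has_sum_add[OF has_sum_cmult_right[OF S1, of "2 / \<alpha> 1"] has_sum_cmult_right[OF S2, of "32 * C\<^sup>2"]]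
    by (simp add: Bell_def w_def algebra_simps)
  have "?m I * Bell I + (osc fu I K)\<^sup>2 * ?m I / d \<le> 2 / \<alpha> 1 * S1 + 32 * C\<^sup>2 * S2"
  proof (cases "?u I = 0")
    case True
    have xJ: "?x J = 0" if "J \<in> K" for J
      using avg_fu_eq_0[OF K[OF that] avg_eq_0_subset[OF P that True]] .
    have "osc fu I K = 0"
      by (rule osc_fu_eq_0[OF P True])
    moreover have "((\<lambda>J. ?m J * Bell J) has_sum 0) K"
      by (intro has_sum_0) (simp add: Bell_def xJ)
    then have "2 / \<alpha> 1 * S1 + 32 * C\<^sup>2 * S2 = 0"
      using sum_B has_sum_unique by blast
    ultimately show ?thesis
      by (simp add: Bell_def avg_fu_eq_0[OF I True])
  next
    case False
    then have uI: "0 < ?u I"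
      using u0[OF I] by simp
    define q where "q = ?x I / ?u I"
    have "((\<lambda>J. ?m J * ?x J - q * (?m J * ?u J)) has_sum ?m I * ?x I - q * (?m I * ?u I)) K"
      by (intro has_sum_diff has_sum_cmult_right sum_x sum_u)
    from has_sum_abs_exists[OF this] obtain A'
      where "((\<lambda>J. \<bar>?m J * ?x J - q * (?m J * ?u J)\<bar>) has_sum A') K" ..
    moreover have "\<bar>?m J * ?x J - q * (?m J * ?u J)\<bar> = ?m J * \<bar>?x J - q * ?u J\<bar>" for J
      by (simp add: abs_mult_pos' right_diff_distrib mult.left_commute)
    moreover define a where "a = A' / ?m I"
    ultimately have A: "((\<lambda>J. ?m J * \<bar>?x J - q * ?u J\<bar>) has_sum ?m I * a) K"
      using m by simp
    \<comment> \<open>With q = x_I / u_I the tangent plane has the value x_I^2 / u_I at I, and l = 2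
      a / u_I maximizes l a - l^2 u_I / 4, with maximum a^2 / u_I.\<close>
    have "2 * a / ?u I * (?m I * a) \<le> S1 - 2 * q * (?m I * ?x I) + (q\<^sup>2 + (2 * a / ?u I)\<^sup>2 / 4) * (?m I * ?u I)"
      by (rule has_sum_quadratic[OF _ _ _ sum_x sum_u S1 A]) (use u0[OF K] avg_fu_eq_0[OF K] in auto)
    moreover have "2 * a / ?u I * (?m I * a) = 2 * (?m I * (a\<^sup>2 / ?u I))"
      "2 * q * (?m I * ?x I) = 2 * (?m I * ((?x I)\<^sup>2 / ?u I))"
      "(q\<^sup>2 + (2 * a / ?u I)\<^sup>2 / 4) * (?m I * ?u I) = ?m I * ((?x I)\<^sup>2 / ?u I) + ?m I * (a\<^sup>2 / ?u I)"
      using uI by (simp_all add: q_def power2_eq_square field_simps)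
    ultimately have gap1: "?m I * (a\<^sup>2 / ?u I) \<le> S1 - ?m I * ((?x I)\<^sup>2 / ?u I)"
      by linarith
    have wI: "0 < w I" "w I \<le> 2 * C * ?u I"
      using uI C_pos pot_nonneg[OF I] pot_le_C[OF I] by (auto simp: w_def intro: add_pos_nonneg)
    define p where "p = ?x I / w I"
    have "((\<lambda>J. ?m J * ?x J - p * (?m J * w J)) has_sum ?m I * ?x I - p * (C * (?m I * ?u I) + Mp)) K"
      by (intro has_sum_diff has_sum_cmult_right sum_x sum_w)
    from has_sum_abs_exists[OF this] obtain A2
      where "((\<lambda>J. \<bar>?m J * ?x J - p * (?m J * w J)\<bar>) has_sum A2) K" ..
    moreover have "\<bar>?m J * ?x J - p * (?m J * w J)\<bar> = ?m J * \<bar>?x J - p * w J\<bar>" for J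
      by (simp add: abs_mult_pos' right_diff_distrib mult.left_commute)
    ultimately have A2: "((\<lambda>J. ?m J * \<bar>?x J - p * w J\<bar>) has_sum A2) K"
      by simp
    have wJ: "?x J = 0" if "J \<in> K" "w J = 0" for J
    proof -
      have "C * ?u J = 0"
        using that(2) pot_nonneg[OF K[OF that(1)]] u0[OF K[OF that(1)]] C_pos
        by (simp add: w_def add_nonneg_eq_0_iff)
      then show ?thesis
        using C_pos avg_fu_eq_0[OF K[OF that(1)]] by simp
    qed
    \<comment> \<open>The choice l = 0 leaves plain convexity. The tangent plane at (x_I, w_I) has
      slope - p^2 in w, so a mean of w below w_I by osc^2 / (4 d) raises the sum by p^2 osc^2 / (4
      d) per unit of measure.\<close>
    have "0 * A2 \<le> S2 - 2 * p * (?m I * ?x I) + (p\<^sup>2 + 0\<^sup>2 / 4) * (C * (?m I * ?u I) + Mp)"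
      by (rule has_sum_quadratic[OF _ _ _ sum_x sum_w S2 A2]) (use w0[OF K] wJ in auto)
    also have "\<dots> \<le> S2 - 2 * p * (?m I * ?x I)
        + (p\<^sup>2 + 0\<^sup>2 / 4) * (C * (?m I * ?u I) + ?m I * (pot I - (osc u I K)\<^sup>2 / (4 * d)))"
      by (intro add_left_mono mult_left_mono Mp(2)) simp
    also have "\<dots> = S2 - 2 * p * (?m I * ?x I) + p\<^sup>2 * (?m I * w I) - ?m I * (p\<^sup>2 * ((osc u I K)\<^sup>2 / (4 * d)))"
      by (simp add: w_def algebra_simps)
    also have "\<dots> = S2 - ?m I * ((?x I)\<^sup>2 / w I) - ?m I * (p\<^sup>2 * ((osc u I K)\<^sup>2 / (4 * d)))"
      using wI(1) by (simp add: p_def power2_eq_square field_simps)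
    finally have gap2: "?m I * (p\<^sup>2 * ((osc u I K)\<^sup>2 / (4 * d))) \<le> S2 - ?m I * ((?x I)\<^sup>2 / w I)"
      by simp
    have d: "d = 0 \<or> ?u I * \<alpha> 1 \<le> d"
      unfolding d_def by (rule denominator_ge[OF I uI])
    moreover have "0 < ?u I * \<alpha> 1"
      using uI alpha_pos[of 1] by simp
    ultimately have d0: "0 \<le> d"
      by linarith
    have a_d: "a\<^sup>2 / d \<le> 1 / \<alpha> 1 * (a\<^sup>2 / ?u I)"
    proof (cases "d = 0")
      case True
      then show ?thesis
        using uI alpha_pos[of 1] by simp
    next
      case False
      then have "a\<^sup>2 / d \<le> a\<^sup>2 / (?u I * \<alpha> 1)"
        using d uI alpha_pos[of 1] d0 by (intro divide_left_mono) auto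
      then show ?thesis
        by (simp add: mult.commute)
    qed
    \<comment> \<open>The bound \<open>pot\<close> <= C u enters here: it gives w_I <= 2 C u_I,
      which lets p replace q.\<close>
    have q_p: "q\<^sup>2 \<le> 4 * C\<^sup>2 * p\<^sup>2"
    proof -
      have "(w I)\<^sup>2 \<le> (2 * C * ?u I)\<^sup>2"
        using wI by (intro power_mono) auto
      then have "(?x I)\<^sup>2 * (w I)\<^sup>2 \<le> (?x I)\<^sup>2 * (2 * C * ?u I)\<^sup>2"
        by (intro mult_left_mono) auto
      then show ?thesis
        using uI wI(1) by (simp add: q_def p_def power_divide divide_simps power_mult_distrib mult_ac)
    qed
    have "?m I * osc fu I K \<le> ?m I * a + \<bar>q\<bar> * (?m I * osc u I K)"
    proof (rule has_sum_mono)
      show "((\<lambda>J. ?m J * \<bar>?x J - ?x I\<bar>) has_sum ?m I * osc fu I K) K"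
        by (intro has_sum_osc P set_integrable_fu I)
      show "((\<lambda>J. ?m J * \<bar>?x J - q * ?u J\<bar> + \<bar>q\<bar> * (?m J * \<bar>?u J - ?u I\<bar>))
          has_sum ?m I * a + \<bar>q\<bar> * (?m I * osc u I K)) K"
        by (intro has_sum_add has_sum_cmult_right A has_sum_osc P u)
      fix J
      have "q * ?u I = ?x I"
        using uI by (simp add: q_def)
      then have "?x J - ?x I = (?x J - q * ?u J) + q * (?u J - ?u I)"
        by (simp add: right_diff_distrib)
      then have "\<bar>?x J - ?x I\<bar> \<le> \<bar>?x J - q * ?u J\<bar> + \<bar>q\<bar> * \<bar>?u J - ?u I\<bar>"
        using abs_triangle_ineq[of "?x J - q * ?u J" "q * (?u J - ?u I)"] by (simp only: abs_mult)
      from mult_left_mono[OF this, of "?m J"]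
      show "?m J * \<bar>?x J - ?x I\<bar> \<le> ?m J * \<bar>?x J - q * ?u J\<bar> + \<bar>q\<bar> * (?m J * \<bar>?u J - ?u I\<bar>)"
        by (simp add: algebra_simps)
    qed
    then have "?m I * osc fu I K \<le> ?m I * (a + \<bar>q\<bar> * osc u I K)"
      by (simp add: algebra_simps)
    then have osc_le: "osc fu I K \<le> a + \<bar>q\<bar> * osc u I K"
      using m by simp
    have "(osc fu I K)\<^sup>2 \<le> (a + \<bar>q\<bar> * osc u I K)\<^sup>2"
      using osc_le by (intro power_mono) (auto simp: osc_def intro!: divide_nonneg_nonneg infsum_nonneg)
    also have "\<dots> \<le> 2 * a\<^sup>2 + 2 * q\<^sup>2 * (osc u I K)\<^sup>2"
      using zero_le_power2[of "a - \<bar>q\<bar> * osc u I K"]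
      by (simp add: power2_eq_square algebra_simps flip: abs_mult)
    finally have "(osc fu I K)\<^sup>2 / d \<le> (2 * a\<^sup>2 + 2 * q\<^sup>2 * (osc u I K)\<^sup>2) / d"
      by (intro divide_right_mono d0)
    also have "\<dots> = 2 * (a\<^sup>2 / d) + 2 * (q\<^sup>2 * ((osc u I K)\<^sup>2 / d))"
      by (simp add: add_divide_distrib)
    also have "\<dots> \<le> 2 * (1 / \<alpha> 1 * (a\<^sup>2 / ?u I)) + 2 * (4 * C\<^sup>2 * p\<^sup>2 * ((osc u I K)\<^sup>2 / d))"
      using d0 by (intro add_mono mult_left_mono mult_right_mono a_d q_p) auto
    also have "\<dots> = 2 / \<alpha> 1 * (a\<^sup>2 / ?u I) + 32 * C\<^sup>2 * (p\<^sup>2 * ((osc u I K)\<^sup>2 / (4 * d)))"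
      by simp
    finally have "?m I * ((osc fu I K)\<^sup>2 / d)
        \<le> ?m I * (2 / \<alpha> 1 * (a\<^sup>2 / ?u I) + 32 * C\<^sup>2 * (p\<^sup>2 * ((osc u I K)\<^sup>2 / (4 * d))))"
      using m by (intro mult_left_mono) auto
    also have "\<dots> = 2 / \<alpha> 1 * (?m I * (a\<^sup>2 / ?u I)) + 32 * C\<^sup>2 * (?m I * (p\<^sup>2 * ((osc u I K)\<^sup>2 / (4 * d))))"
      by (simp add: algebra_simps)
    also have "\<dots> \<le> 2 / \<alpha> 1 * (S1 - ?m I * ((?x I)\<^sup>2 / ?u I)) + 32 * C\<^sup>2 * (S2 - ?m I * ((?x I)\<^sup>2 / w I))"
      using alpha_pos[of 1] by (intro add_mono mult_left_mono gap1 gap2) auto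
    finally show ?thesis
      by (simp add: Bell_def w_def algebra_simps)
  qed
  then show ?thesis
    using that[OF sum_B] by (simp add: d_def)
qed

end

subsection \<open>Summation over the filtration\<close>

context weight
begin

lemma avg_const_on:
  assumes "cell J" "\<And>x. x \<in> J \<Longrightarrow> g x = c"
  shows "avg M g J = c"
proof -
  have "(LINT x:J|M. g x) = (LINT x:J|M. c)"
    using assms by (intro set_lebesgue_integral_cong) (auto simp: cell_def)
  also have "\<dots> = measure M J * c"
    using assms(1) by (simp add: cell_def set_lebesgue_integral_def)
  finally show ?thesis
    using cell_pos[OF assms(1)] by (simp add: avg_def)
qed

lemma Delta_on_child:
  assumes P: "partition I (ch D I)" and J: "J \<in> ch D I" and x: "x \<in> J"
  shows "Delta M D I g x = avg M g J - avg M g I"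
proof -
  have "x \<notin> J'" if "J' \<in> ch D I" "J' \<noteq> J" for J'
  proof -
    have "disjoint (ch D I)"
      using P by (simp add: partition_def)
    then have "J \<inter> J' = {}"
      using that J by (simp add: disjointD)
    then show ?thesis using x by auto
  qed
  then have "((\<lambda>I'. avg M g I' * indicator I' x) has_sum (\<Sum>I'\<in>{J}. avg M g I' * indicator I' x)) (ch D I)"
    using J by (intro has_sum_finite_neutralI[where B = "{J}"]) (auto simp: indicator_def)
  then have "(\<Sum>\<^sub>\<infinity>I'\<in>ch D I. avg M g I' * indicator I' x) = avg M g J"
    using x by (simp add: infsumI)
  moreover have "x \<in> I"
    using partition_subset[OF P J] x by auto
  ultimately show ?thesis
    by (simp add: Delta_def)
qed

lemma L1norm_nonneg: "0 \<le> L1norm M g I"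
  unfolding L1norm_def avg_def set_lebesgue_integral_def
  by (intro divide_nonneg_nonneg integral_nonneg_AE AE_I2) auto

text \<open>\<open>Delta\<close> is constant on each child, so its norm equals \<open>osc\<close> if
  it is integrable. Otherwise the Bochner integral is 0 by convention, and the inequality, enough
  for an upper bound, still holds.\<close>

lemma L1norm_Delta_le_osc:
  assumes P: "partition I (ch D I)" and g: "set_integrable M I g"
  shows "L1norm M (Delta M D I g) I \<le> osc g I (ch D I)"
proof (cases "set_integrable M I (\<lambda>x. \<bar>Delta M D I g x\<bar>)")
  case True
  have "avg M (\<lambda>x. \<bar>Delta M D I g x\<bar>) J = \<bar>avg M g J - avg M g I\<bar>" if "J \<in> ch D I" for J
    using that by (intro avg_const_on partition_cells[OF P]) (simp_all add: Delta_on_child[OF P])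
  then have "((\<lambda>J. measure M J * avg M (\<lambda>x. \<bar>Delta M D I g x\<bar>) J) has_sum s) (ch D I) \<longleftrightarrow>
      ((\<lambda>J. measure M J * \<bar>avg M g J - avg M g I\<bar>) has_sum s) (ch D I)" for s
    by (intro has_sum_cong) simp
  then have "((\<lambda>J. measure M J * \<bar>avg M g J - avg M g I\<bar>) has_sum
      measure M I * L1norm M (Delta M D I g) I) (ch D I)"
    using has_sum_avg[OF P True] by (simp add: L1norm_def)
  then have "measure M I * L1norm M (Delta M D I g) I = measure M I * osc g I (ch D I)"
    using has_sum_osc[OF P g] has_sum_unique by blast
  then show ?thesis
    using cell_pos[OF partition_cell[OF P]] by simp
next
  case False
  then have "L1norm M (Delta M D I g) I = 0"
    by (simp add: L1norm_def avg_def set_lebesgue_integral_def set_integrable_def not_integrable_integral_eq)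
  also have "\<dots> \<le> osc g I (ch D I)"
    unfolding osc_def by (intro divide_nonneg_nonneg infsum_nonneg) auto
  finally show ?thesis .
qed

end

section \<open>Cells and children in the filtration\<close>

locale bump_filtration = bump_fun M u \<alpha> f for M :: "'a measure" and u \<alpha> f +
  fixes D :: "int \<Rightarrow> 'a set set"
  assumes filt: "atomic_filtration M D"
    and u_loc: "\<And>I. I \<in> allD D \<Longrightarrow> set_integrable M I u"
begin

text \<open>Children relative to level n, whether or not n is the last level containing I. A cell
  that stays in \<open>D (n + 1)\<close> has itself as only child, so every level can be refined
  cell by cell; \<open>ch_level\<close> links this to \<open>ch\<close>.\<close>

definition kids :: "int \<Rightarrow> 'a set \<Rightarrow> 'a set set" where
  "kids n I = {J \<in> D (n + 1). J \<subseteq> I}"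

lemma
  shows D_countable: "countable (D n)" and D_disjoint: "disjoint (D n)"
    and D_sets: "\<forall>n. \<forall>I\<in>D n. I \<in> sets M \<and> 0 < emeasure M I \<and> emeasure M I < \<infinity>"
    and D_atoms: "\<forall>n. \<forall>A\<in>gen_sa M D n. \<exists>F\<subseteq>D n. A = \<Union>F"
    and gen_sa_mono: "\<forall>n. gen_sa M D n \<subseteq> gen_sa M D (n + 1)"
proof -
  note F2 = conjunct2[OF filt[unfolded atomic_filtration_def]]
  note F3 = conjunct2[OF F2]
  note F4 = conjunct2[OF F3]
  note F6 = conjunct2[OF conjunct2[OF F4]]
  show "countable (D n)" "disjoint (D n)"
    by (rule spec[OF conjunct1[OF F2]], rule spec[OF conjunct1[OF F3]])
  show "\<forall>n. \<forall>I\<in>D n. I \<in> sets M \<and> 0 < emeasure M I \<and> emeasure M I < \<infinity>"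
    by (rule conjunct1[OF F4])
  show "\<forall>n. \<forall>A\<in>gen_sa M D n. \<exists>F\<subseteq>D n. A = \<Union>F"
    by (rule conjunct1[OF F6])
  show "\<forall>n. gen_sa M D n \<subseteq> gen_sa M D (n + 1)"
    by (rule conjunct1[OF conjunct2[OF F6]])
qed

lemma D_cell:
  assumes "I \<in> D n"
  shows "cell I"
proof -
  have "I \<in> sets M \<and> 0 < emeasure M I \<and> emeasure M I < \<infinity>"
    using D_sets assms by simp
  moreover have "set_integrable M I u"
    using assms by (intro u_loc) (auto simp: allD_def)
  ultimately show ?thesis
    by (simp add: cell_def)
qed

lemma D_nonempty: "I \<in> D n \<Longrightarrow> I \<noteq> {}"
  using D_cell[of I n] by (auto simp: cell_def)

lemma gen_sa_Union:
  assumes "A \<in> gen_sa M D n"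
  obtains F where "F \<subseteq> D n" "A = \<Union>F"
  using D_atoms assms that by meson

lemma D_Union: "\<Union>(D n) = space M"
proof
  show "\<Union>(D n) \<subseteq> space M"
    using D_cell cell_sets sets.sets_into_space by blast
  have "space M \<in> gen_sa M D n"
    by (simp add: gen_sa_def sigma_sets_top)
  then show "space M \<subseteq> \<Union>(D n)"
    by (rule gen_sa_Union) auto
qed

lemma D_Union_next:
  assumes "I \<in> D n"
  obtains F where "F \<subseteq> D (n + 1)" "I = \<Union>F"
proof -
  have "I \<in> gen_sa M D n"
    using assms by (auto simp: gen_sa_def)
  then have "I \<in> gen_sa M D (n + 1)"
    using spec[OF gen_sa_mono, of n] by (rule rev_subsetD)
  then show ?thesis
    using that by (rule gen_sa_Union)
qed

lemma partition_kids:
  assumes I: "I \<in> D n"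
  shows "partition I (kids n I)"
proof -
  have sub: "kids n I \<subseteq> D (n + 1)"
    by (auto simp: kids_def)
  obtain F where "F \<subseteq> D (n + 1)" "I = \<Union>F"
    using D_Union_next[OF I] .
  then have "\<Union>(kids n I) = I"
    by (auto simp: kids_def)
  moreover have "disjoint (kids n I)"
    using D_disjoint[of "n + 1"] sub by (rule pairwise_subset)
  ultimately show ?thesis
    using sub D_cell I countable_subset[OF sub D_countable] by (auto simp: partition_def)
qed

text \<open>A point of J lies in some cell I of \<open>D n\<close>, as \<open>D n\<close> covers the
  space. This I is a union of cells of \<open>D (n + 1)\<close>, and by disjointness the one through
  the point is J.\<close>

lemma kids_Union: "(\<Union>I\<in>D n. kids n I) = D (n + 1)"
proof
  show "D (n + 1) \<subseteq> (\<Union>I\<in>D n. kids n I)"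
  proof
    fix J assume J: "J \<in> D (n + 1)"
    then obtain x where x: "x \<in> J"
      using D_nonempty by blast
    then have "x \<in> \<Union>(D n)"
      using J D_Union[of n] D_Union[of "n + 1"] by blast
    then obtain I where I: "I \<in> D n" "x \<in> I" by blast
    obtain F where F: "F \<subseteq> D (n + 1)" "I = \<Union>F"
      using D_Union_next[OF I(1)] .
    then obtain J' where J': "J' \<in> F" "x \<in> J'"
      using I(2) by blast
    have "J' = J"
    proof (rule ccontr)
      assume "J' \<noteq> J"
      then have "J' \<inter> J = {}"
        using J J' F(1) by (intro disjointD[OF D_disjoint[of "n + 1"]]) auto
      then show False using x J'(2) by auto
    qed
    then show "J \<in> (\<Union>I\<in>D n. kids n I)"
      using I J J' F by (auto simp: kids_def)
  qed
qed (auto simp: kids_def)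

lemma kids_disjoint: "disjoint_family_on (kids n) (D n)"
  unfolding disjoint_family_on_def
proof (intro ballI impI equals0I)
  fix I I' J assume I: "I \<in> D n" "I' \<in> D n" "I \<noteq> I'" and J: "J \<in> kids n I \<inter> kids n I'"
  have "I \<inter> I' = {}"
    using D_disjoint[of n] I by (simp add: disjointD)
  moreover have "J \<subseteq> I \<inter> I'" "J \<noteq> {}"
    using J D_nonempty[of J "n + 1"] by (auto simp: kids_def)
  ultimately show False by simp
qed

section \<open>Sums of \<open>Bell\<close> over one level\<close>

definition total :: "int \<Rightarrow> real" where
  "total n = (\<Sum>\<^sub>\<infinity>I\<in>D n. measure M I * Bell I)"

lemma has_sum_ffu: "((\<lambda>I. 34 * C * (measure M I * avg M ffu I)) has_sum 34 * C * (\<integral>x. ffu x \<partial>M)) (D n)"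
proof (rule has_sum_cmult_right)
  have "((\<lambda>I. LINT x:I|M. ffu x) has_sum (LINT x:\<Union>(D n)|M. ffu x)) (D n)"
  proof (rule has_sum_set_integral[OF D_countable D_disjoint])
    show "D n \<subseteq> sets M"
      using D_cell cell_sets by blast
    show "set_integrable M (\<Union>(D n)) ffu"
      unfolding D_Union by (intro set_integrable_ffu sets.top)
  qed
  moreover have "((\<lambda>I. measure M I * avg M ffu I) has_sum s) (D n) \<longleftrightarrow>
      ((\<lambda>I. LINT x:I|M. ffu x) has_sum s) (D n)" for s
    by (intro has_sum_cong measure_mult_avg D_cell)
  moreover have "(LINT x:\<Union>(D n)|M. ffu x) = (\<integral>x. ffu x \<partial>M)"
    unfolding D_Union set_lebesgue_integral_def by (intro Bochner_Integration.integral_cong) auto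
  ultimately show "((\<lambda>I. measure M I * avg M ffu I) has_sum (\<integral>x. ffu x \<partial>M)) (D n)"
    by simp
qed

lemma Bell_mult_le:
  assumes "cell I"
  shows "measure M I * Bell I \<le> 34 * C * (measure M I * avg M ffu I)"
  using mult_left_mono[OF Bell_le[OF assms], of "measure M I"] by (simp add: mult_ac)

lemma has_sum_total: "((\<lambda>I. measure M I * Bell I) has_sum total n) (D n)"
proof -
  have "(\<lambda>I. measure M I * Bell I) summable_on D n"
    by (rule summable_on_comparison_test[OF has_sum_imp_summable[OF has_sum_ffu]])
      (auto intro!: Bell_mult_le mult_nonneg_nonneg Bell_nonneg dest: D_cell)
  then show ?thesis
    by (simp add: total_def)
qed

lemma total_le: "total n \<le> 34 * C * (\<integral>x. ffu x \<partial>M)"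
  by (rule has_sum_mono[OF has_sum_total has_sum_ffu]) (intro Bell_mult_le D_cell)

lemma total_nonneg: "0 \<le> total n"
  by (rule has_sum_nonneg[OF has_sum_total]) (auto intro!: mult_nonneg_nonneg Bell_nonneg dest: D_cell)

definition den :: "'a set \<Rightarrow> real" where
  "den I = \<alpha> (ustar M u I / avg M u I) * ustar M u I"

lemma den_nonneg:
  assumes "cell I" "0 < avg M u I"
  shows "0 \<le> den I"
proof -
  have "0 < avg M u I * \<alpha> 1"
    using assms alpha_pos[of 1] by simp
  then show ?thesis
    using denominator_ge[OF assms] unfolding den_def by linarith
qed

lemma osc_term_nonneg:
  assumes P: "partition I K"
  shows "0 \<le> (osc fu I K)\<^sup>2 * measure M I / den I"
proof (cases "avg M u I = 0")
  case True
  then show ?thesis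
    using osc_fu_eq_0[OF P] by simp
next
  case False
  then have "0 < avg M u I"
    using avg_nonneg[of I] partition_cell[OF P] by (simp add: cell_def)
  then show ?thesis
    using den_nonneg[OF partition_cell[OF P]] by simp
qed

text \<open>\<open>Bell_submartingale\<close> is summed over \<open>D n\<close>, with
  \<open>D (n + 1)\<close> regrouped by parents. The gains are collected on a finite G, so that
  their summability can be derived afterwards from this bound.\<close>

lemma total_step:
  assumes G: "finite G" "G \<subseteq> D n"
  shows "total n + (\<Sum>I\<in>G. (osc fu I (kids n I))\<^sup>2 * measure M I / den I) \<le> total (n + 1)"
proof -
  let ?b = "\<lambda>I. measure M I * Bell I"
  let ?t = "\<lambda>I. (osc fu I (kids n I))\<^sup>2 * measure M I / den I"
  have "\<forall>I\<in>D n. \<exists>S. (?b has_sum S) (kids n I) \<and> ?b I + ?t I \<le> S"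
  proof
    fix I assume I: "I \<in> D n"
    obtain S where "(?b has_sum S) (kids n I)" "?b I + ?t I \<le> S"
      unfolding den_def by (rule Bell_submartingale[OF partition_kids[OF I]])
    then show "\<exists>S. (?b has_sum S) (kids n I) \<and> ?b I + ?t I \<le> S" by blast
  qed
  from bchoice[OF this] obtain s
    where *: "\<forall>I\<in>D n. (?b has_sum s I) (kids n I) \<and> ?b I + ?t I \<le> s I" ..
  have s: "(?b has_sum s I) (kids n I)" "?b I + ?t I \<le> s I" if "I \<in> D n" for I
    using bspec[OF * that] by simp_all
  have le: "?b I \<le> s I" if "I \<in> D n" for I
    using s(2)[OF that] osc_term_nonneg[OF partition_kids[OF that]] by linarith
  \<comment> \<open>A cell of \<open>D (n + 1)\<close> has a single parent in \<open>D n\<close>, so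
    the sum over \<open>D (n + 1)\<close> is one over pairs of parent and child and can be taken
    parent by parent.\<close>
  have inj: "inj_on snd (Sigma (D n) (kids n))"
  proof (rule inj_onI)
    fix p p' assume p: "p \<in> Sigma (D n) (kids n)" "p' \<in> Sigma (D n) (kids n)" "snd p = snd p'"
    have "fst p = fst p'"
    proof (rule ccontr)
      assume "fst p \<noteq> fst p'"
      then have "kids n (fst p) \<inter> kids n (fst p') = {}"
        using p by (intro disjoint_family_onD[OF kids_disjoint[of n]]) auto
      moreover have "snd p \<in> kids n (fst p) \<inter> kids n (fst p')"
        using p by auto
      ultimately show False by blast
    qed
    then show "p = p'"
      using p(3) by (simp add: prod_eq_iff)
  qed
  have "snd ` Sigma (D n) (kids n) = (\<Union>I\<in>D n. kids n I)"
    by (auto simp: image_iff)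
  also have "\<dots> = D (n + 1)"
    by (rule kids_Union)
  finally have img: "snd ` Sigma (D n) (kids n) = D (n + 1)" .
  have "((\<lambda>p. ?b (snd p)) has_sum total (n + 1)) (Sigma (D n) (kids n))"
    using has_sum_total[of "n + 1"] unfolding img[symmetric] has_sum_reindex[OF inj] by (simp add: o_def)
  then have sum_s: "(s has_sum total (n + 1)) (D n)"
    by (rule has_sum_Sigma') (simp add: s)
  have "((\<lambda>I. ?b I + (if I \<in> G then ?t I else 0)) has_sum
      total n + (\<Sum>I\<in>G. if I \<in> G then ?t I else 0)) (D n)"
    using G by (intro has_sum_add has_sum_total has_sum_finite_neutralI) auto
  then have "total n + (\<Sum>I\<in>G. if I \<in> G then ?t I else 0) \<le> total (n + 1)"
    by (rule has_sum_mono[OF _ sum_s]) (use s(2) le in auto)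
  then show ?thesis
    by simp
qed

section \<open>From levels to the sum over all cells\<close>

definition level :: "'a set \<Rightarrow> int \<Rightarrow> bool" where
  "level I n \<longleftrightarrow> I \<in> D n \<and> (\<forall>m>n. I \<notin> D m)"

definition summand :: "'a set \<Rightarrow> real" where
  "summand I = (L1norm M (Delta M D I fu) I)\<^sup>2 * measure M I / den I"

lemma level_unique: "level I n \<Longrightarrow> level I m \<Longrightarrow> n = m"
  unfolding level_def by (metis linorder_neqE)

lemma ch_level:
  assumes "level I n"
  shows "ch D I = kids n I"
proof -
  have "(THE n. I \<in> D n \<and> (\<forall>m>n. I \<notin> D m)) = n"
    using assms level_unique[of I] unfolding level_def by (intro the_equality) auto
  moreover have "\<exists>n. I \<in> D n \<and> (\<forall>m>n. I \<notin> D m)"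
    using assms unfolding level_def by blast
  ultimately show ?thesis
    by (simp add: ch_def kids_def Let_def)
qed

text \<open>Without a last level \<open>ch\<close> is {I}, so \<open>Delta\<close> vanishes
  identically.\<close>

lemma summand_no_level:
  assumes "\<nexists>n. level I n"
  shows "summand I = 0"
proof -
  have "ch D I = {I}"
    using assms unfolding ch_def level_def by (rule if_not_P)
  moreover have "(\<Sum>\<^sub>\<infinity>I'\<in>{I}. h I') = h I" for h :: "'a set \<Rightarrow> real"
    by simp
  ultimately have "Delta M D I fu x = 0" for x
    by (simp only: Delta_def diff_self)
  then show ?thesis
    by (simp add: summand_def L1norm_def avg_def)
qed

lemma
  assumes I: "level I n"
  shows summand_nonneg_level: "0 \<le> summand I"
    and summand_le: "summand I \<le> (osc fu I (kids n I))\<^sup>2 * measure M I / den I"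
proof -
  have P: "partition I (kids n I)"
    using I by (intro partition_kids) (simp add: level_def)
  note cI = partition_cell[OF P]
  have "L1norm M (Delta M D I fu) I \<le> osc fu I (kids n I)"
    using L1norm_Delta_le_osc[of I D fu] P set_integrable_fu[OF cI] by (simp add: ch_level[OF I])
  then have sq: "(L1norm M (Delta M D I fu) I)\<^sup>2 \<le> (osc fu I (kids n I))\<^sup>2"
    by (intro power_mono L1norm_nonneg)
  have "0 \<le> summand I \<and> summand I \<le> (osc fu I (kids n I))\<^sup>2 * measure M I / den I"
  proof (cases "avg M u I = 0")
    case True
    then have "osc fu I (kids n I) = 0"
      by (rule osc_fu_eq_0[OF P])
    then show ?thesis
      using sq by (simp add: summand_def)
  next
    case False
    then have "0 \<le> den I"
      using avg_nonneg[of I] cI by (intro den_nonneg cI) (simp add: cell_def)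
    then show ?thesis
      unfolding summand_def by (auto intro!: divide_right_mono mult_right_mono sq)
  qed
  then show "0 \<le> summand I" "summand I \<le> (osc fu I (kids n I))\<^sup>2 * measure M I / den I"
    by simp_all
qed

lemma summand_nonneg: "0 \<le> summand I"
  using summand_nonneg_level[of I] summand_no_level[of I] by (cases "\<exists>n. level I n") auto

text \<open>Telescoping over N consecutive levels: \<open>total\<close> is nonnegative at the
  bottom, and each \<open>total_step\<close> adds the gains of those cells of F whose last level is
  the current one. A cell lying in several \<open>D n\<close> is thus counted once.\<close>

lemma sum_levels_le:
  assumes F: "finite F"
  shows "(\<Sum>I\<in>{I\<in>F. \<exists>n. level I n \<and> a \<le> n \<and> n < a + int N}. summand I) \<le> total (a + int N)"
proof (induction N)
  case 0
  have none: "{I\<in>F. \<exists>n. level I n \<and> a \<le> n \<and> n < a + int 0} = {}"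
    by auto
  show ?case
    unfolding none using total_nonneg[of a] by simp
next
  case (Suc N)
  let ?A = "{I\<in>F. \<exists>n. level I n \<and> a \<le> n \<and> n < a + int N}" and ?G = "{I\<in>F. level I (a + int N)}"
  have "{I\<in>F. \<exists>n. level I n \<and> a \<le> n \<and> n < a + int (Suc N)} = ?A \<union> ?G"
  proof -
    have "a \<le> n \<and> n < a + int (Suc N) \<longleftrightarrow> (a \<le> n \<and> n < a + int N) \<or> n = a + int N" for n
      by auto
    then show ?thesis by blast
  qed
  moreover have "?A \<inter> ?G = {}"
  proof -
    have False if "level I n" "n < a + int N" "level I (a + int N)" for I n
      using level_unique[OF that(1,3)] that(2) by simp
    then show ?thesis by blast
  qed
  ultimately have "(\<Sum>I\<in>{I\<in>F. \<exists>n. level I n \<and> a \<le> n \<and> n < a + int (Suc N)}. summand I) =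
      sum summand ?A + sum summand ?G"
    using F by (simp add: sum.union_disjoint)
  also have "\<dots> \<le> total (a + int N) + (\<Sum>I\<in>?G. (osc fu I (kids (a + int N) I))\<^sup>2 * measure M I / den I)"
    by (intro add_mono Suc.IH sum_mono summand_le) simp
  also have "\<dots> \<le> total (a + int N + 1)"
    using F by (intro total_step) (auto simp: level_def)
  finally show ?case
    by (simp add: ac_simps)
qed

lemma sum_summand_le:
  assumes F: "finite F"
  shows "sum summand F \<le> 34 * C * (\<integral>x. ffu x \<partial>M)"
proof -
  define l where "l I = (THE n. level I n)" for I
  have l: "l I = n" if "level I n" for I n
    unfolding l_def using that level_unique by (intro the_equality) auto
  \<comment> \<open>The + 1 makes the bound on the levels strict, so they lie in the half-open
    window from - b to b, of length 2 b. For a cell without level l I is arbitrary, which can only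
    enlarge b.\<close>
  define b where "b = (\<Sum>I\<in>F. \<bar>l I\<bar>) + 1"
  have "\<bar>l I\<bar> < b" if "I \<in> F" for I
    using member_le_sum[OF that, of "\<lambda>I. \<bar>l I\<bar>"] F unfolding b_def by simp
  then have bound: "- b \<le> n \<and> n < - b + int (nat (2 * b))" if "I \<in> F" "level I n" for I n
    using l[OF that(2)] that(1) by fastforce
  have "sum summand F = (\<Sum>I\<in>{I\<in>F. \<exists>n. level I n \<and> - b \<le> n \<and> n < - b + int (nat (2 * b))}. summand I)"
  proof (rule sum.mono_neutral_right[OF F])
    show "\<forall>I\<in>F - {I\<in>F. \<exists>n. level I n \<and> - b \<le> n \<and> n < - b + int (nat (2 * b))}. summand I = 0"
    proof
      fix I assume I: "I \<in> F - {I\<in>F. \<exists>n. level I n \<and> - b \<le> n \<and> n < - b + int (nat (2 * b))}"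
      have "\<not> level I n" for n
        using I bound[of I n] by blast
      then show "summand I = 0"
        by (intro summand_no_level) simp
    qed
  qed auto
  also have "\<dots> \<le> total (- b + int (nat (2 * b)))"
    by (rule sum_levels_le[OF F])
  also have "\<dots> \<le> 34 * C * (\<integral>x. ffu x \<partial>M)"
    by (rule total_le)
  finally show ?thesis .
qed

lemma summand_summable: "summand summable_on A"
  and infsum_summand_le: "(\<Sum>\<^sub>\<infinity>I\<in>A. summand I) \<le> 36 * C * (\<integral>x. ffu x \<partial>M)"
proof -
  show summable: "summand summable_on A"
    by (rule nonneg_bdd_above_summable_on)
      (auto intro!: summand_nonneg bdd_aboveI[where M = "34 * C * (\<integral>x. ffu x \<partial>M)"] sum_summand_le)
  have "(\<Sum>\<^sub>\<infinity>I\<in>A. summand I) \<le> 34 * C * (\<integral>x. ffu x \<partial>M)"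
    by (intro infsum_le_finite_sums summable sum_summand_le)
  \<comment> \<open>The integral is nonnegative because u is, so 34 may be raised to 36.\<close>
  also have "\<dots> \<le> 36 * C * (\<integral>x. ffu x \<partial>M)"
    using C_pos u_nonneg by (intro mult_right_mono integral_nonneg_AE AE_I2) auto
  finally show "(\<Sum>\<^sub>\<infinity>I\<in>A. summand I) \<le> 36 * C * (\<integral>x. ffu x \<partial>M)" .
qed

end

theorem theorem6p1:
  fixes M :: "'a measure" and D :: "int \<Rightarrow> 'a set set"
    and \<alpha> :: "real \<Rightarrow> real" and u f :: "'a \<Rightarrow> real"
  assumes filt: "atomic_filtration M D"
    and alpha_pos: "\<forall>t\<ge>1. 0 < \<alpha> t"
    and alpha_mono: "mono_on {1..} \<alpha>"
    and C_fin: "set_integrable lborel {1..} (\<lambda>t. 1 / (t * \<alpha> t))"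
    and u_meas: "u \<in> borel_measurable M"
    and u_nonneg: "\<forall>x\<in>space M. 0 \<le> u x"
    and u_loc: "\<forall>I\<in>allD D. set_integrable M I u"
    and f_meas: "f \<in> borel_measurable M"
    and f_L2: "integrable M (\<lambda>x. (f x)\<^sup>2 * u x)"
  shows "(\<lambda>I. (L1norm M (Delta M D I (\<lambda>x. f x * u x)) I)\<^sup>2 * measure M I
              / (\<alpha> (ustar M u I / avg M u I) * ustar M u I)) summable_on allD D
       \<and> (\<Sum>\<^sub>\<infinity>I\<in>allD D. (L1norm M (Delta M D I (\<lambda>x. f x * u x)) I)\<^sup>2 * measure M I
              / (\<alpha> (ustar M u I / avg M u I) * ustar M u I))
         \<le> 36 * (1 / \<alpha> 1 + (LBINT t:{1..}. 1 / (t * \<alpha> t))) * (\<integral>x. (f x)\<^sup>2 * u x \<partial>M)"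
proof -
  interpret sigma_finite_measure M
    using filt unfolding atomic_filtration_def by (rule conjunct1)
  interpret bump_filtration M u \<alpha> f D
    by unfold_locales (use assms in simp_all)
  show ?thesis
    using summand_summable[of "allD D"] infsum_summand_le[of "allD D"]
    unfolding summand_def [abs_def] den_def C_def phi_top_def by blast
qed

end
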